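(* Let the upstream link 1 and the downstream link 2 carry the uniform initial states $U(x,0)=U_1=(D_1,S_1)$ for $x<0$ and $U(x,0)=U_2=(D_2,S_2)$ for $x>0$. Then stationary states $U_1^-$ (a traffic state of link 1) and $U_2^+$ (a traffic state of link 2) are admissible if and only if $$U_1^-=(D_1,C_1)\quad\text{or}\quad U_1^-=(C_1,S_1^-)\ \text{ with } S_1^-<D_1,$$ and $$U_2^+=(C_2,S_2)\quad\text{or}\quad U_2^+=(D_2^+,C_2)\ \text{ with } D_2^+<S_2 .$$
   Context: Setting: the inhomogeneous Lighthill-Whitham-Richards (LWR) model $\partial_t\rho+\partial_x Q(x,\rho)=0$ on the line, where $Q(x,\rho)=Q_1(\rho)$ for $x<0$ (upstream link 1) and $Q(x,\rho)=Q_2(\rho)$ for $x>0$ (downstream link 2); $x=0$ is called a linear boundary. Fundamental diagrams: for $i=1,2$, $Q_i:[0,\rho_{j,i}]\to[0,\infty)$ is a continuous, piecewise continuously differentiable function with $Q_i(0)=Q_i(\rho_{j,i})=0$ that is unimodal: strictly increasing on $[0,\rho_{c,i}]$ and strictly decreasing on $[\rho_{c,i},\rho_{j,i}]$, with capacity $C_i=Q_i(\rho_{c,i})>0$. Concavity is not assumed. Supply-demand representation: the demand and supply of density $\rho$ on link $i$ are $D_i(\rho)=Q_i(\min\{\rho,\rho_{c,i}\})$ and $S_i(\rho)=Q_i(\max\{\rho,\rho_{c,i}\})$. The map $\rho\mapsto(D_i(\rho),S_i(\rho))$ is a bijection from $[0,\rho_{j,i}]$ onto $\{(D,S): D,S\ge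 0,\ \max\{D,S\}=C_i\}$; elements $U=(D,S)$ of this set are called traffic states of link $i$ and are identified with the corresponding densities. The flux of a state is $q(U)=\min\{D,S\}$. Stationary states: in the solution framework, the wave on link 1 is the solution, restricted to $x<0$, of the Riemann problem for the homogeneous LWR model $\partial_t\rho+\partial_x Q_1(\rho)=0$ with left state $U_1$ and right state $U_1^-$; the wave on link 2 is the solution, restricted to $x>0$, of the Riemann problem for $\partial_t\rho+\partial_x Q_2(\rho)=0$ with left state $U_2^+$ and right state $U_2$. Here $U_1^-$ and $U_2^+$ are the stationary states, i.e. the states to which the two links tend as $t\to\infty$ at any fixed location of the link. Admissibility: $U_1^-$ is admissible if the first Riemann problem has no wave of positive speed and $U_1^-$ is actually the state attained on link 1 at the boundary; that is, writing the self-similar entropy solution as $w(x/t)$, one has $\lim_{\xi\to0^-}w(\xi)=U_1^-$ (thus a zero-speed shock from $U_1$ to a different state $U_1^-$ is not allowed). Likewise $U_2^+$ is admissible if the second Riemann problem has no wave of negative speed and its self-similar entropy solution $w(x/t)$ satisfies $\lim_{\xi\to0^+}w(\xi)=U_2^+$. *)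

theory Defs
  imports "HOL-Analysis.Analysis"
begin

record link =
  flux :: "real \<Rightarrow> real"
  crit :: real
  jam  :: real

text \<open>Only the values of the flux on \<open>{0..jam L}\<close> are meaningful.  Concavity is not assumed.  The
  finite exceptional set in \<open>piecewise_C1_differentiable_on\<close> may contain the two endpoints.\<close>

definition fundamental_diagram :: "link \<Rightarrow> bool" where
  "fundamental_diagram L \<longleftrightarrow>
     crit L \<in> {0..jam L} \<and>
     flux L ` {0..jam L} \<subseteq> {0..} \<and>
     continuous_on {0..jam L} (flux L) \<and>
     flux L piecewise_C1_differentiable_on {0..jam L} \<and>
     flux L 0 = 0 \<and> flux L (jam L) = 0 \<and>
     strict_mono_on {0..crit L} (flux L) \<and>
     strict_antimono_on {crit L..jam L} (flux L) \<and>
     0 < flux L (crit L)"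

definition capacity :: "link \<Rightarrow> real" where
  "capacity L = flux L (crit L)"

definition link_demand :: "link \<Rightarrow> real \<Rightarrow> real" where
  "link_demand L r = flux L (min r (crit L))"

definition link_supply :: "link \<Rightarrow> real \<Rightarrow> real" where
  "link_supply L r = flux L (max r (crit L))"

type_synonym state = "real \<times> real"

definition state_of :: "link \<Rightarrow> real \<Rightarrow> state" where
  "state_of L r = (link_demand L r, link_supply L r)"

definition traffic_states :: "link \<Rightarrow> state set" where
  "traffic_states L = {(D, S). 0 \<le> D \<and> 0 \<le> S \<and> max D S = capacity L}"

definition density :: "link \<Rightarrow> state \<Rightarrow> real" where
  "density L = the_inv_into {0..jam L} (state_of L)"

lemma bij_betw_state_of:
  assumes "fundamental_diagram L"
  shows "bij_betw (state_of L) {0..jam L} (traffic_states L)"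
proof -
  let ?Q = "flux L" and ?c = "crit L" and ?j = "jam L"
  have c: "0 \<le> ?c" "?c \<le> ?j" and nn: "\<And>r. r \<in> {0..?j} \<Longrightarrow> 0 \<le> ?Q r"
    and cont: "continuous_on {0..?j} ?Q" and ends: "?Q 0 = 0" "?Q ?j = 0"
    and inc: "\<And>r s. 0 \<le> r \<Longrightarrow> r < s \<Longrightarrow> s \<le> ?c \<Longrightarrow> ?Q r < ?Q s"
    and dec: "\<And>r s. ?c \<le> r \<Longrightarrow> r < s \<Longrightarrow> s \<le> ?j \<Longrightarrow> ?Q s < ?Q r"
    using assms unfolding fundamental_diagram_def monotone_on_def image_subset_iff by auto
  have inc_le: "?Q r \<le> ?Q s" if "0 \<le> r" "r \<le> s" "s \<le> ?c" for r s
    using inc[of r s] that by (cases "r = s") auto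
  have dec_le: "?Q s \<le> ?Q r" if "?c \<le> r" "r \<le> s" "s \<le> ?j" for r s
    using dec[of r s] that by (cases "r = s") auto
  have inj: "r = s" if r: "r \<in> {0..?j}" and s: "s \<in> {0..?j}" and lt: "state_of L r = state_of L s"
    for r s
  proof (rule ccontr)
    assume ne: "r \<noteq> s"
    have *: False if "r < s" "r \<in> {0..?j}" "s \<in> {0..?j}" "state_of L r = state_of L s" for r s
    proof (cases "r < ?c")
      case True
      then have "?Q r < ?Q (min s ?c)"
        using inc[of r "min s ?c"] that by auto
      with True that show False
        by (auto simp: state_of_def link_demand_def min_def)
    next
      case False
      then show False
        using dec[of r s] that by (auto simp: state_of_def link_supply_def max_def)
    qed
    from ne r s lt *[of r s] *[of s r] show False by (cases "r < s") auto
  qed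
  have "state_of L r \<in> traffic_states L" if r: "r \<in> {0..?j}" for r
  proof (cases "r \<le> ?c")
    case True
    then show ?thesis
      using r c nn[of r] nn[of ?c] inc_le[of r ?c]
      by (simp add: state_of_def link_demand_def link_supply_def traffic_states_def capacity_def)
  next
    case False
    then show ?thesis
      using r c nn[of r] nn[of ?c] dec_le[of ?c r]
      by (simp add: state_of_def link_demand_def link_supply_def traffic_states_def capacity_def)
  qed
  moreover have "U \<in> state_of L ` {0..?j}" if U: "U \<in> traffic_states L" for U
  proof -
    obtain D S where DS: "U = (D, S)" "0 \<le> D" "0 \<le> S" "max D S = ?Q ?c"
      using U by (auto simp: traffic_states_def capacity_def)
    show ?thesis
    proof (cases "S = ?Q ?c")
      case True
      then have "D \<le> ?Q ?c" using DS by linarith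
      moreover have "continuous_on {0..?c} ?Q"
        using cont by (rule continuous_on_subset) (use c in auto)
      ultimately obtain r where "0 \<le> r" "r \<le> ?c" "?Q r = D"
        using IVT'[of ?Q 0 D ?c] c ends DS by auto
      then have "state_of L r = U" "r \<in> {0..?j}"
        using True DS c by (auto simp: state_of_def link_demand_def link_supply_def min_def max_def)
      then show ?thesis by blast
    next
      case False
      then have D: "D = ?Q ?c" and "S \<le> ?Q ?c" using DS by (auto simp: max_def split: if_splits)
      moreover have "continuous_on {?c..?j} ?Q"
        using cont by (rule continuous_on_subset) (use c in auto)
      ultimately obtain r where "?c \<le> r" "r \<le> ?j" "?Q r = S"
        using IVT2'[of ?Q ?j S ?c] c ends DS by auto
      then have "state_of L r = U" "r \<in> {0..?j}"
        using D DS c by (auto simp: state_of_def link_demand_def link_supply_def min_def max_def)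
      then show ?thesis by blast
    qed
  qed
  ultimately show ?thesis
    using inj unfolding bij_betw_def inj_on_def by blast
qed

text \<open>Points of the plane are pairs \<open>(x, t)\<close>.  A test function is a nonnegative compactly supported
  \<open>C\<^sup>1\<close> function \<open>\<phi>\<close> with partial derivatives \<open>\<phi>x\<close> and \<open>\<phi>t\<close>; it need not vanish on \<open>t = 0\<close>.\<close>

definition test_function ::
    "(real \<times> real \<Rightarrow> real) \<Rightarrow> (real \<times> real \<Rightarrow> real) \<Rightarrow> (real \<times> real \<Rightarrow> real) \<Rightarrow> bool" where
  "test_function \<phi> \<phi>x \<phi>t \<longleftrightarrow>
     (\<forall>p. 0 \<le> \<phi> p) \<and>
     (\<forall>p. (\<phi> has_derivative (\<lambda>h. \<phi>x p * fst h + \<phi>t p * snd h)) (at p)) \<and>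
     continuous_on UNIV \<phi>x \<and> continuous_on UNIV \<phi>t \<and>
     compact (closure {p. \<phi> p \<noteq> 0})"

text \<open>Kruzkov entropy solutions of \<open>\<partial>\<^sub>t u + \<partial>\<^sub>x f(u) = 0\<close>, \<open>u(\<cdot>, 0) = u0\<close>, with values in the
  compact interval \<open>I\<close> on which the flux is defined.  The extreme values of \<open>k\<close> in \<open>I\<close> give the two
  inequalities that make up the weak form of the conservation law.\<close>

definition entropy_solution ::
    "(real \<Rightarrow> real) \<Rightarrow> real set \<Rightarrow> (real \<Rightarrow> real) \<Rightarrow> (real \<times> real \<Rightarrow> real) \<Rightarrow> bool" where
  "entropy_solution f I u0 u \<longleftrightarrow>
     set_borel_measurable borel (UNIV \<times> {0<..}) u \<and>
     (\<forall>x. \<forall>t>0. u (x, t) \<in> I) \<and>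
     (\<forall>k\<in>I. \<forall>\<phi> \<phi>x \<phi>t. test_function \<phi> \<phi>x \<phi>t \<longrightarrow>
        0 \<le> (LINT p:(UNIV \<times> {0<..})|lborel.
               \<bar>u p - k\<bar> * \<phi>t p + sgn (u p - k) * (f (u p) - f k) * \<phi>x p)
           + (LINT x|lborel. \<bar>u0 x - k\<bar> * \<phi> (x, 0)))"

definition riemann_data :: "real \<Rightarrow> real \<Rightarrow> real \<Rightarrow> real" where
  "riemann_data a b x = (if x < 0 then a else b)"

definition riemann_solution :: "link \<Rightarrow> real \<Rightarrow> real \<Rightarrow> (real \<Rightarrow> real) \<Rightarrow> bool" where
  "riemann_solution L a b w \<longleftrightarrow>
     entropy_solution (flux L) {0..jam L} (riemann_data a b) (\<lambda>(x, t). w (x / t))"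

text \<open>Entropy solutions are determined up to null sets only, hence the quantification over the
  profile \<open>w\<close>.  Having no wave of positive (negative) speed means that \<open>w\<close> is constant on the
  positive (negative) half-line.\<close>

definition admissible_upstream :: "link \<Rightarrow> state \<Rightarrow> state \<Rightarrow> bool" where
  "admissible_upstream L U V \<longleftrightarrow>
     (\<exists>w. riemann_solution L (density L U) (density L V) w \<and>
          w constant_on {0<..} \<and>
          (w \<longlongrightarrow> density L V) (at_left 0))"

definition admissible_downstream :: "link \<Rightarrow> state \<Rightarrow> state \<Rightarrow> bool" where
  "admissible_downstream L U V \<longleftrightarrow>
     (\<exists>w. riemann_solution L (density L V) (density L U) w \<and>
          w constant_on {..<0} \<and>
          (w \<longlongrightarrow> density L V) (at_right 0))"

end

theory Submission
  imports Defs
begin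

text \<open>The two links do not interact in the statement, so the theorem is a statement about each of two Riemann
  problems for a scalar conservation law.  Write \<open>f\<close> for the flux, \<open>a\<close> for the density of the initial state of a
  link and \<open>b\<close> for the density of the candidate stationary state, which is the other state of the Riemann problem.
  On the upstream link, \<open>b\<close> is admissible if and only if

    \<^item> \<open>f b < f k\<close> for all \<open>k\<close> with \<open>a \<le> k < b\<close>, and
    \<^item> \<open>f k < f b\<close> for all \<open>k\<close> with \<open>b < k \<le> a\<close>

  (\<open>left_wave_iff\<close>).  This holds for every continuous flux.  For a unimodal flux the two conditions single out the
  densities \<open>b\<close> whose demand-supply pair is \<open>(D, C)\<close> or \<open>(C, S')\<close> with \<open>S' < D\<close>, where \<open>D\<close> is the demand of
  \<open>a\<close> and \<open>C\<close> the capacity (\<open>upstream_states_iff\<close>).  The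
  reflection \<open>x \<mapsto> - x\<close> turns the downstream problem into an upstream problem with flux \<open>- f\<close>, and the reflection
  \<open>u \<mapsto> - u\<close> reduces everything to \<open>a \<le> b\<close>.

  Suppose the condition holds and \<open>a \<le> b\<close>.  The profile \<open>w \<xi>\<close> that minimises \<open>f v - \<xi> v\<close> over \<open>{a..b}\<close> solves
  the Riemann problem: the minimum is a concave function of \<open>\<xi>\<close> with slope \<open>- w \<xi>\<close>, and subtracting the affine
  function \<open>f k - \<xi> k\<close>, above which it cannot rise when \<open>k\<close> is in \<open>{a..b}\<close>, gives Kruzkov's inequality for \<open>k\<close>
  (\<open>minimiser_entropy_increment\<close>).  Strict minimality of \<open>f b\<close> makes \<open>b\<close> the only
  minimiser for \<open>\<xi> > 0\<close> and forces \<open>w \<xi>\<close> towards \<open>b\<close> as \<open>\<xi>\<close> increases to \<open>0\<close> (\<open>left_wave_exists\<close>).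

  Conversely, let an entropy solution have the trace \<open>b\<close> at \<open>\<xi> = 0\<close> from the left, and let \<open>a \<le> k < b\<close>.  The entropy
  \<open>(u - k)\<^sup>+\<close> vanishes initially on \<open>x < 0\<close> but is positive close to the boundary at later times.  It cannot have been
  produced inside, so it must have entered, and it can have entered only through the boundary, where its flux is
  \<open>f b - f k\<close>.  Hence \<open>f b < f k\<close> (\<open>left_trace_flux_less\<close>).  Since the derivative of the flux may be unbounded,
  the domain of dependence behind this argument uses \<open>f v - f k \<le> \<delta> + C (v - k)\<close> for \<open>v > k\<close> with small \<open>\<delta>\<close> in
  place of a Lipschitz bound.\<close>

section \<open>Test functions and integration over the half-plane\<close>

lemma integrable_bounded_support:
  fixes g :: "'a::euclidean_space \<Rightarrow> real"
  assumes "g \<in> borel_measurable borel" "compact S"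
    and "\<And>p. p \<in> S \<Longrightarrow> \<bar>g p\<bar> \<le> K" "\<And>p. p \<notin> S \<Longrightarrow> g p = 0"
  shows "integrable lborel g"
  using assms emeasure_compact_finite[OF assms(2)]
  by (intro integrableI_bounded_set[where A=S and B=K]) (auto simp: borel_compact)

lemma bounded_if_zero_outside_compact:
  fixes g :: "'a::topological_space \<Rightarrow> real"
  assumes "continuous_on UNIV g" "compact S" "\<And>p. p \<notin> S \<Longrightarrow> g p = 0"
  obtains K where "K > 0" "\<And>p. \<bar>g p\<bar> \<le> K"
proof -
  have "bounded (g ` S)"
    using assms(1,2) by (meson compact_continuous_image compact_imp_bounded continuous_on_subset subset_UNIV)
  then obtain K where "\<And>p. p \<in> S \<Longrightarrow> \<bar>g p\<bar> \<le> K"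
    by (auto simp: bounded_iff)
  then have "\<bar>g p\<bar> \<le> max K 1" for p
    using assms(3)[of p] by (cases "p \<in> S") (fastforce simp: le_max_iff_disj)+
  with that[of "max K 1"] show ?thesis by auto
qed

text \<open>Integrability over the plane, and with it Fubini's theorem and dominated convergence, rests on these
  bounds.\<close>

lemma test_functionE:
  assumes "test_function \<phi> \<phi>x \<phi>t"
  obtains R K where "R > 0" "K > 0" "\<And>p. \<bar>\<phi> p\<bar> \<le> K" "\<And>p. \<bar>\<phi>x p\<bar> \<le> K" "\<And>p. \<bar>\<phi>t p\<bar> \<le> K"
    "\<And>x t. R < \<bar>x\<bar> \<or> R < \<bar>t\<bar> \<Longrightarrow> \<phi> (x, t) = 0 \<and> \<phi>x (x, t) = 0 \<and> \<phi>t (x, t) = 0"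
proof -
  have nn: "\<And>p. 0 \<le> \<phi> p" and
    der: "\<And>p. (\<phi> has_derivative (\<lambda>h. \<phi>x p * fst h + \<phi>t p * snd h)) (at p)" and
    cx: "continuous_on UNIV \<phi>x" and ct: "continuous_on UNIV \<phi>t" and
    comp: "compact (closure {p. \<phi> p \<noteq> 0})" (is "compact ?S")
    using assms unfolding test_function_def by auto
  have c: "continuous_on UNIV \<phi>"
    using der by (meson continuous_at_imp_continuous_on has_derivative_continuous)
  \<comment> \<open>A zero of the nonnegative function \<open>\<phi>\<close> is a minimum, so the gradient vanishes there.\<close>
  have zero: "\<phi>x p = 0 \<and> \<phi>t p = 0" if "\<phi> p = 0" for p
  proof -
    have "(\<lambda>h. \<phi>x p * fst h + \<phi>t p * snd h) = (\<lambda>h. 0)"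
      using differential_zero_maxmin[OF _ open_UNIV der, of p] nn that by auto
    from fun_cong[OF this, of "(1,0)"] fun_cong[OF this, of "(0,1)"] show ?thesis by simp
  qed
  have out: "\<phi> p = 0" if "p \<notin> ?S" for p
    using that closure_subset[of "{p. \<phi> p \<noteq> 0}"] by auto
  obtain K1 where K1: "K1 > 0" "\<And>p. \<bar>\<phi> p\<bar> \<le> K1"
    using bounded_if_zero_outside_compact[OF c comp out] by metis
  obtain K2 where K2: "K2 > 0" "\<And>p. \<bar>\<phi>x p\<bar> \<le> K2"
    using bounded_if_zero_outside_compact[OF cx comp] out zero by metis
  obtain K3 where K3: "K3 > 0" "\<And>p. \<bar>\<phi>t p\<bar> \<le> K3"
    using bounded_if_zero_outside_compact[OF ct comp] out zero by metis
  obtain R where R: "R > 0" "\<And>p. p \<in> ?S \<Longrightarrow> norm p \<le> R"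
    using compact_imp_bounded[OF comp] by (auto simp: bounded_pos)
  have z: "\<phi> (x, t) = 0" if "R < \<bar>x\<bar> \<or> R < \<bar>t\<bar>" for x t
  proof (rule out)
    show "(x, t) \<notin> ?S"
      using R(2)[of "(x, t)"] that norm_fst_le[of "(x, t)"] norm_snd_le[of "(x, t)"]
        norm_fst_le[of x t] norm_snd_le[of t x]
      by (auto simp: not_le)
  qed
  show ?thesis
  proof (rule that[of R "max K1 (max K2 K3)"])
    show "max K1 (max K2 K3) > 0" using K1(1) by simp
    show "\<And>p. \<bar>\<phi> p\<bar> \<le> max K1 (max K2 K3)" using K1(2) by (simp add: le_max_iff_disj)
    show "\<And>p. \<bar>\<phi>x p\<bar> \<le> max K1 (max K2 K3)" using K2(2) by (simp add: le_max_iff_disj)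
    show "\<And>p. \<bar>\<phi>t p\<bar> \<le> max K1 (max K2 K3)" using K3(2) by (simp add: le_max_iff_disj)
  qed (use R(1) z zero in auto)
qed

lemma test_function_continuous:
  assumes "test_function \<phi> \<phi>x \<phi>t"
  shows "continuous_on UNIV \<phi>" "continuous_on UNIV \<phi>x" "continuous_on UNIV \<phi>t"
  using assms unfolding test_function_def
  by (auto intro!: continuous_at_imp_continuous_on has_derivative_continuous)

lemma test_function_measurable:
  assumes "test_function \<phi> \<phi>x \<phi>t"
  shows "\<phi> \<in> borel_measurable borel" "\<phi>x \<in> borel_measurable borel" "\<phi>t \<in> borel_measurable borel"
  using test_function_continuous[OF assms] by (auto intro: borel_measurable_continuous_onI)

text \<open>Used along horizontal and vertical lines and along the rays \<open>x = \<xi> t\<close>.\<close>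

lemma test_function_curve:
  assumes "test_function \<phi> \<phi>x \<phi>t"
    and "(g has_real_derivative g') (at s)" "(h has_real_derivative h') (at s)"
  shows "((\<lambda>s. \<phi> (g s, h s)) has_real_derivative \<phi>x (g s, h s) * g' + \<phi>t (g s, h s) * h') (at s)"
proof -
  have "((\<lambda>s. (g s, h s)) has_derivative (\<lambda>d. (g' * d, h' * d))) (at s)"
    using assms(2,3) unfolding has_field_derivative_def by (rule has_derivative_Pair)
  moreover have "(\<phi> has_derivative (\<lambda>d. \<phi>x (g s, h s) * fst d + \<phi>t (g s, h s) * snd d)) (at (g s, h s))"
    using assms(1) unfolding test_function_def by blast
  ultimately have "((\<lambda>s. \<phi> (g s, h s)) has_derivative
      (\<lambda>d. \<phi>x (g s, h s) * (g' * d) + \<phi>t (g s, h s) * (h' * d))) (at s)"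
    using has_derivative_compose by fastforce
  then show ?thesis
    by (rule has_derivative_imp_has_field_derivative) (simp add: algebra_simps)
qed

lemma LINT_halfline_derivative:
  fixes g :: "real \<Rightarrow> real"
  assumes der: "\<And>x. (g has_real_derivative g' x) (at x)" and cont: "continuous_on UNIV g'"
    and z: "\<And>x. R < x \<Longrightarrow> g x = 0 \<and> g' x = 0"
  shows "(LINT x|lborel. indicator {c<..} x * g' x) = - g c"
proof -
  define d where "d = max c (R + 1)"
  have "(LINT x|lborel. g' x * indicator {c..d} x) = g d - g c"
    using der cont
    by (intro integral_FTC_Icc_real) (auto simp: d_def continuous_on_eq_continuous_at)
  moreover have "g d = 0" using z[of d] by (auto simp: d_def)
  moreover have "(LINT x|lborel. indicator {c<..} x * g' x) = (LINT x|lborel. g' x * indicator {c..d} x)"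
  proof (rule integral_cong_AE)
    have [measurable]: "g' \<in> borel_measurable borel"
      using cont by (rule borel_measurable_continuous_onI)
    show "(\<lambda>x. indicator {c<..} x * g' x) \<in> borel_measurable lborel"
      "(\<lambda>x. g' x * indicator {c..d} x) \<in> borel_measurable lborel" by measurable
    show "AE x in lborel. indicator {c<..} x * g' x = g' x * indicator {c..d} x"
      using AE_lborel_singleton[of c]
    proof eventually_elim
      case (elim x)
      then show ?case using z[of x] by (cases "x \<le> d") (auto simp: indicator_def d_def)
    qed
  qed
  ultimately show ?thesis by simp
qed

lemma LINT_line_derivative:
  fixes g :: "real \<Rightarrow> real"
  assumes der: "\<And>x. (g has_real_derivative g' x) (at x)" and cont: "continuous_on UNIV g'"
    and z: "\<And>x. R < \<bar>x\<bar> \<Longrightarrow> g x = 0 \<and> g' x = 0"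
  shows "(LINT x|lborel. g' x) = 0"
proof -
  have "(LINT x|lborel. g' x) = (LINT x|lborel. indicator {- \<bar>R\<bar> - 1<..} x * g' x)"
    using z by (intro Bochner_Integration.integral_cong) (auto simp: indicator_def)
  also have "\<dots> = - g (- \<bar>R\<bar> - 1)"
    using z by (intro LINT_halfline_derivative[OF der cont, of R]) auto
  also have "\<dots> = 0" using z[of "- \<bar>R\<bar> - 1"] by auto
  finally show ?thesis .
qed


section \<open>The profile that minimises the tilted flux\<close>

lemma integrable_mult_compact_support:
  fixes q g :: "real \<Rightarrow> real"
  assumes "q \<in> borel_measurable borel" "g \<in> borel_measurable borel"
    and "\<And>x. \<bar>q x\<bar> \<le> A + B * \<bar>x\<bar>" "B \<ge> 0" "\<And>x. \<bar>g x\<bar> \<le> K" "\<And>x. R < \<bar>x\<bar> \<Longrightarrow> g x = 0"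
  shows "integrable lborel (\<lambda>x. q x * g x)"
proof (rule integrable_bounded_support[where S = "{-R..R}" and K = "(A + B * R) * K"])
  show "(\<lambda>x. q x * g x) \<in> borel_measurable borel" using assms(1,2) by measurable
  show "\<bar>q x * g x\<bar> \<le> (A + B * R) * K" if "x \<in> {-R..R}" for x
  proof -
    have "B * \<bar>x\<bar> \<le> B * R" using that assms(4) by (intro mult_left_mono) auto
    then have "\<bar>q x\<bar> \<le> A + B * R" using assms(3)[of x] by linarith
    then show ?thesis
      unfolding abs_mult using assms(5)[of x] by (intro mult_mono) auto
  qed
qed (use assms(6) in auto)

lemma difference_quotient_LIMSEQ:
  fixes q \<psi> :: "real \<Rightarrow> real"
  assumes q: "q \<in> borel_measurable borel" "\<And>x. \<bar>q x\<bar> \<le> A + B * \<bar>x\<bar>" "B \<ge> 0"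
    and der: "\<And>x. (\<psi> has_real_derivative \<psi>' x) (at x)" and cont: "continuous_on UNIV \<psi>'"
    and z: "\<And>x. R < \<bar>x\<bar> \<Longrightarrow> \<psi> x = 0 \<and> \<psi>' x = 0" and bd: "\<And>x. \<bar>\<psi>' x\<bar> \<le> K"
    and d: "\<And>n. 0 < d n" "\<And>n. d n \<le> 1" "d \<longlonglongrightarrow> (0::real)"
  shows "(\<lambda>n. LINT x|lborel. q x * ((\<psi> (x + d n) - \<psi> x) / d n)) \<longlonglongrightarrow> (LINT x|lborel. q x * \<psi>' x)"
proof (rule integral_dominated_convergence[where w = "\<lambda>x. indicator {-R-1..R+1} x * ((A + B * (\<bar>R\<bar> + 1)) * K)"])
  have [measurable]: "\<psi> \<in> borel_measurable borel" "\<psi>' \<in> borel_measurable borel" "q \<in> borel_measurable borel"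
    using q(1) cont DERIV_continuous[OF der]
    by (auto intro!: borel_measurable_continuous_onI continuous_at_imp_continuous_on)
  show "(\<lambda>x. q x * \<psi>' x) \<in> borel_measurable lborel"
    "\<And>n. (\<lambda>x. q x * ((\<psi> (x + d n) - \<psi> x) / d n)) \<in> borel_measurable lborel" by measurable
  show "integrable lborel (\<lambda>x. indicator {-R-1..R+1} x * ((A + B * (\<bar>R\<bar> + 1)) * K))"
    by (intro integrable_mult_left integrable_real_indicator) (auto simp: emeasure_lborel_Icc_eq)
  show "AE x in lborel. (\<lambda>n. q x * ((\<psi> (x + d n) - \<psi> x) / d n)) \<longlonglongrightarrow> q x * \<psi>' x"
  proof (intro AE_I2 tendsto_intros)
    fix x
    have "(\<lambda>h. (\<psi> (x + h) - \<psi> x) / h) \<midarrow>0\<rightarrow> \<psi>' x"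
      using der[of x] by (simp add: DERIV_def)
    moreover have "filterlim d (at 0) sequentially"
      using d(3) d(1) by (auto simp: filterlim_at intro!: always_eventually) (metis less_irrefl)
    ultimately show "(\<lambda>n. (\<psi> (x + d n) - \<psi> x) / d n) \<longlonglongrightarrow> \<psi>' x"
      by (rule filterlim_compose)
  qed
  show "AE x in lborel. norm (q x * ((\<psi> (x + d n) - \<psi> x) / d n))
      \<le> indicator {-R-1..R+1} x * ((A + B * (\<bar>R\<bar> + 1)) * K)" for n
  proof (intro AE_I2)
    fix x
    show "norm (q x * ((\<psi> (x + d n) - \<psi> x) / d n)) \<le> indicator {-R-1..R+1} x * ((A + B * (\<bar>R\<bar> + 1)) * K)"
    proof (cases "x \<in> {-R-1..R+1}")
      case True
      have "\<exists>y. x < y \<and> y < x + d n \<and> \<psi> (x + d n) - \<psi> x = (x + d n - x) * \<psi>' y"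
        using d(1)[of n] der by (intro MVT2) auto
      then obtain y where "\<psi> (x + d n) - \<psi> x = d n * \<psi>' y" by auto
      then have "\<bar>(\<psi> (x + d n) - \<psi> x) / d n\<bar> \<le> K"
        using bd[of y] d(1)[of n] by simp
      moreover have "\<bar>q x\<bar> \<le> A + B * (\<bar>R\<bar> + 1)"
        using q(2)[of x] mult_left_mono[OF _ q(3), of "\<bar>x\<bar>" "\<bar>R\<bar> + 1"] True
        by (simp add: abs_le_iff) linarith
      ultimately have "\<bar>q x\<bar> * \<bar>(\<psi> (x + d n) - \<psi> x) / d n\<bar> \<le> (A + B * (\<bar>R\<bar> + 1)) * K"
        by (intro mult_mono) auto
      with True show ?thesis by (simp add: abs_mult)
    next
      case False
      then have "R < \<bar>x\<bar> \<and> R < \<bar>x + d n\<bar>" using d(1)[of n] d(2)[of n] by auto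
      then show ?thesis using z False by simp
    qed
  qed
qed

text \<open>A pointwise lower bound on the decrements of \<open>p\<close> gives \<open>p' \<le> - \<eta>\<close> in the sense of distributions.
  The correction \<open>w x - w (x - d)\<close> in the hypothesis, which tolerates the jumps of \<open>w\<close>, is harmless: integrated
  against \<open>\<psi>\<close> it is \<open>- w\<close> times an increment of \<open>\<psi>\<close>, hence of order \<open>d\<close>.\<close>

lemma weak_inequality_from_increments:
  fixes p w \<eta> \<psi> :: "real \<Rightarrow> real"
  assumes meas: "p \<in> borel_measurable borel" "w \<in> borel_measurable borel" "\<eta> \<in> borel_measurable borel"
    and bds: "\<And>x. \<bar>p x\<bar> \<le> A + B * \<bar>x\<bar>" "B \<ge> 0" "\<And>x. \<bar>w x\<bar> \<le> W" "\<And>x. \<bar>\<eta> x\<bar> \<le> W"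
    and incr: "\<And>x d. 0 < d \<Longrightarrow> d * (\<eta> x - (w x - w (x - d))) \<le> p (x - d) - p x"
    and der: "\<And>x. (\<psi> has_real_derivative \<psi>' x) (at x)" and cont: "continuous_on UNIV \<psi>'"
    and z: "\<And>x. R < \<bar>x\<bar> \<Longrightarrow> \<psi> x = 0 \<and> \<psi>' x = 0"
    and nn: "\<And>x. 0 \<le> \<psi> x" and bd: "\<And>x. \<psi> x \<le> K" "\<And>x. \<bar>\<psi>' x\<bar> \<le> K"
  shows "0 \<le> (LINT x|lborel. p x * \<psi>' x - \<eta> x * \<psi> x)"
proof -
  define d where "d n = 1 / real (Suc n)" for n
  have d: "\<And>n. 0 < d n" "\<And>n. d n \<le> 1" "d \<longlonglongrightarrow> 0"
    using LIMSEQ_inverse_real_of_nat by (auto simp: d_def[abs_def] inverse_eq_divide divide_le_eq)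
  have [measurable]: "\<psi> \<in> borel_measurable borel" "\<psi>' \<in> borel_measurable borel"
    using cont DERIV_continuous[OF der]
    by (auto intro!: borel_measurable_continuous_onI continuous_at_imp_continuous_on)
  note [measurable] = meas
  have int: "integrable lborel (\<lambda>x. q x * g x)"
    if "q \<in> borel_measurable borel" "\<And>x. \<bar>q x\<bar> \<le> A' + B * \<bar>x\<bar>"
      "g \<in> borel_measurable borel" "\<And>x. \<bar>g x\<bar> \<le> K'" "\<And>x. R' < \<bar>x\<bar> \<Longrightarrow> g x = 0" for q g A' K' R'
    using that bds(2) by (intro integrable_mult_compact_support)
  have bw: "\<bar>w x\<bar> \<le> W + B * \<bar>x\<bar>" "\<bar>\<eta> x\<bar> \<le> W + B * \<bar>x\<bar>" for x
    using bds(2) bds(3,4)[of x] zero_le_mult_iff[of B "\<bar>x\<bar>"] by linarith+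
  have \<psi>a: "\<bar>\<psi> x\<bar> \<le> K" for x using nn[of x] bd(1)[of x] by simp
  define P where "P n = (LINT x|lborel. p x * ((\<psi> (x + d n) - \<psi> x) / d n))" for n
  define Y where "Y n = (LINT x|lborel. w x * ((\<psi> (x + d n) - \<psi> x) / d n))" for n
  have Plim: "P \<longlonglongrightarrow> (LINT x|lborel. p x * \<psi>' x)"
    unfolding P_def by (rule difference_quotient_LIMSEQ[OF meas(1) bds(1,2) der cont z bd(2) d])
  have Ylim: "Y \<longlonglongrightarrow> (LINT x|lborel. w x * \<psi>' x)"
    unfolding Y_def by (rule difference_quotient_LIMSEQ[OF meas(2) bw(1) bds(2) der cont z bd(2) d])
  have step: "(LINT x|lborel. \<eta> x * \<psi> x) \<le> P n - d n * Y n" for n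
  proof -
    \<comment> \<open>Moving the difference quotient from \<open>\<psi>\<close> onto \<open>q = p - d w\<close> makes the hypothesis on increments
      say exactly that the quotient of \<open>q\<close> dominates \<open>\<eta>\<close>.\<close>
    define q where "q x = p x - d n * w x" for x
    have [measurable]: "q \<in> borel_measurable borel" unfolding q_def by measurable
    have "\<bar>q x\<bar> \<le> (A + W) + B * \<bar>x\<bar>" for x
    proof -
      have "\<bar>d n * w x\<bar> \<le> 1 * W"
        unfolding abs_mult using d(1,2)[of n] bds(3)[of x] by (intro mult_mono) auto
      then show ?thesis unfolding q_def using bds(1)[of x] by linarith
    qed
    note qb = this
    have shifted_bd: "\<bar>q (x - d n)\<bar> \<le> (A + W + B) + B * \<bar>x\<bar>" for x
    proof -
      have "B * \<bar>x - d n\<bar> \<le> B * (\<bar>x\<bar> + 1)"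
        using d(1,2)[of n] bds(2) by (intro mult_left_mono) auto
      then show ?thesis using qb[of "x - d n"] by (simp add: algebra_simps)
    qed
    have i1: "integrable lborel (\<lambda>x. q x * \<psi> (x + d n))"
      using d(1,2)[of n] z \<psi>a by (intro int[OF _ qb, where R' = "R + 1"]) auto
    have i2: "integrable lborel (\<lambda>x. q x * \<psi> x)"
      using z \<psi>a by (intro int[OF _ qb, where R' = R]) auto
    have i3: "integrable lborel (\<lambda>x. q (x - d n) * \<psi> x)"
      using z \<psi>a by (intro int[OF _ shifted_bd, where R' = R]) auto
    have i4: "integrable lborel (\<lambda>x. \<eta> x * \<psi> x)"
      using z \<psi>a by (intro int[OF _ bw(2), where R' = R]) auto
    have dq: "\<bar>\<psi> (x + d n) - \<psi> x\<bar> \<le> 2 * K" "R + 1 < \<bar>x\<bar> \<Longrightarrow> \<psi> (x + d n) - \<psi> x = 0" for x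
      using \<psi>a[of x] \<psi>a[of "x + d n"] d(1,2)[of n] z[of x] z[of "x + d n"] by auto
    have i5: "integrable lborel (\<lambda>x. p x * (\<psi> (x + d n) - \<psi> x))"
      using dq by (intro int[OF _ bds(1)]) auto
    have i6: "integrable lborel (\<lambda>x. w x * (\<psi> (x + d n) - \<psi> x))"
      using dq by (intro int[OF _ bw(1)]) auto
    have "d n * (LINT x|lborel. \<eta> x * \<psi> x) = (LINT x|lborel. d n * (\<eta> x * \<psi> x))" by simp
    also have "\<dots> \<le> (LINT x|lborel. q (x - d n) * \<psi> x - q x * \<psi> x)"
    proof (intro integral_mono)
      fix x
      have "d n * \<eta> x \<le> q (x - d n) - q x"
        using incr[OF d(1), of n x] by (simp add: q_def algebra_simps)
      from mult_right_mono[OF this nn[of x]]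
      show "d n * (\<eta> x * \<psi> x) \<le> q (x - d n) * \<psi> x - q x * \<psi> x" by (simp add: algebra_simps)
    qed (intro Bochner_Integration.integrable_diff integrable_mult_right i2 i3 i4)+
    also have "\<dots> = (LINT x|lborel. q (x - d n) * \<psi> x) - (LINT x|lborel. q x * \<psi> x)"
      using i2 i3 by simp
    also have "(LINT x|lborel. q (x - d n) * \<psi> x) = (LINT x|lborel. q x * \<psi> (x + d n))"
      using lborel_integral_real_affine[of 1 "\<lambda>x. q (x - d n) * \<psi> x" "d n"] by (simp add: add.commute)
    also have "(LINT x|lborel. q x * \<psi> (x + d n)) - (LINT x|lborel. q x * \<psi> x)
        = (LINT x|lborel. q x * \<psi> (x + d n) - q x * \<psi> x)"
      using i1 i2 by simp
    also have "\<dots> = (LINT x|lborel. p x * (\<psi> (x + d n) - \<psi> x) - d n * (w x * (\<psi> (x + d n) - \<psi> x)))"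
      by (intro Bochner_Integration.integral_cong) (auto simp: q_def algebra_simps)
    also have "\<dots> = d n * P n - d n * (d n * Y n)"
      using i5 i6 d(1)[of n] by (simp add: P_def Y_def)
    finally have "d n * (LINT x|lborel. \<eta> x * \<psi> x) \<le> d n * (P n - d n * Y n)"
      by (simp add: algebra_simps)
    then show ?thesis using d(1)[of n] by simp
  qed
  have "(\<lambda>n. P n - d n * Y n) \<longlonglongrightarrow> (LINT x|lborel. p x * \<psi>' x) - 0 * (LINT x|lborel. w x * \<psi>' x)"
    by (intro tendsto_intros Plim Ylim d)
  then have "(LINT x|lborel. \<eta> x * \<psi> x) \<le> (LINT x|lborel. p x * \<psi>' x)"
    using step by (intro LIMSEQ_le_const) auto
  moreover have "integrable lborel (\<lambda>x. p x * \<psi>' x)"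
    using z bd by (intro int[OF _ bds(1)]) auto
  moreover have "integrable lborel (\<lambda>x. \<eta> x * \<psi> x)"
    using z \<psi>a by (intro int[OF _ bw(2)]) auto
  ultimately show ?thesis by simp
qed

lemma minimiser_mono:
  fixes w :: "real \<Rightarrow> real"
  assumes "\<And>\<xi>. w \<xi> \<in> S" "\<And>\<xi> v. v \<in> S \<Longrightarrow> f (w \<xi>) - \<xi> * w \<xi> \<le> f v - \<xi> * v"
  shows "mono w"
proof (rule monoI)
  fix x y :: real assume "x \<le> y"
  have "f (w x) - x * w x \<le> f (w y) - x * w y" "f (w y) - y * w y \<le> f (w x) - y * w x"
    using assms by auto
  then have "0 \<le> (y - x) * (w y - w x)" by (simp add: algebra_simps)
  with \<open>x \<le> y\<close> show "w x \<le> w y" by (cases "x = y") (auto simp: zero_le_mult_iff)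
qed

text \<open>For a self-similar \<open>u = w (x/t)\<close> the entropy inequality for \<open>\<bar>u - k\<bar>\<close> reads \<open>p' \<le> - \<bar>w - k\<bar>\<close>, where
  \<open>p = q - \<xi> \<bar>w - k\<bar>\<close> and \<open>q\<close> is the entropy flux.  Up to sign, \<open>p\<close> is the difference of the Legendre
  transform \<open>f (w \<xi>) - \<xi> w \<xi>\<close>, a minimum of affine functions of \<open>\<xi>\<close> whose slope is \<open>- w\<close>, and of the
  affine function \<open>f k - \<xi> k\<close>.  Comparing the minima at \<open>x\<close> and at \<open>x - d\<close> with each other's
  minimisers bounds the decrement.\<close>

lemma minimiser_entropy_increment:
  fixes w :: "real \<Rightarrow> real" and k :: real
  assumes w: "\<And>\<xi>. w \<xi> \<in> S" "\<And>\<xi> v. v \<in> S \<Longrightarrow> f (w \<xi>) - \<xi> * w \<xi> \<le> f v - \<xi> * v"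
    and S: "convex S" and d: "0 < d"
  defines "p \<equiv> \<lambda>\<xi>. sgn (w \<xi> - k) * (f (w \<xi>) - f k) - \<xi> * \<bar>w \<xi> - k\<bar>"
  shows "d * (\<bar>w x - k\<bar> - (w x - w (x - d))) \<le> p (x - d) - p x"
proof -
  define u v where "u = w x" and "v = w (x - d)"
  have A1: "f u - x * u \<le> f v - x * v" and A2: "f v - (x - d) * v \<le> f u - (x - d) * u"
    using w by (auto simp: u_def v_def)
  have "v \<le> u" using minimiser_mono[OF w] d by (auto simp: u_def v_def mono_def)
  have plus: "p y = (f (w y) - y * w y) - (f k - y * k)" if "k \<le> w y" for y
    using that by (cases "k = w y") (auto simp: p_def sgn_if algebra_simps)
  have minus: "p y = (f k - y * k) - (f (w y) - y * w y)" if "w y \<le> k" for y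
    using that by (cases "k = w y") (auto simp: p_def sgn_if algebra_simps)
  consider "k \<le> v" | "u \<le> k" | "v < k" "k < u" by linarith
  then show ?thesis
  proof cases
    case 1
    then show ?thesis
      using plus[of x] plus[of "x - d"] A1 \<open>v \<le> u\<close> by (simp add: u_def v_def algebra_simps)
  next
    case 2
    have "0 \<le> d * (u - v)" using d \<open>v \<le> u\<close> by simp
    with 2 show ?thesis
      using minus[of x] minus[of "x - d"] A2 \<open>v \<le> u\<close> by (simp add: u_def v_def algebra_simps)
  next
    case 3
    \<comment> \<open>The jump straddles \<open>k\<close>: the minimum property tested with \<open>v = k\<close> gives \<open>p\<close> the sign of a
      downward jump.\<close>
    have "u \<in> S" "v \<in> S" using w(1) by (auto simp: u_def v_def)
    then have "k \<in> S" using S 3 mem_is_interval_1_I[of S v u k] by (simp add: is_interval_convex_1)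
    have "0 \<le> p (x - d)" "p x \<le> 0"
      using 3 plus[of x] minus[of "x - d"] w(2)[OF \<open>k \<in> S\<close>, of x] w(2)[OF \<open>k \<in> S\<close>, of "x - d"]
      by (auto simp: u_def v_def)
    moreover have "d * (\<bar>w x - k\<bar> - (w x - w (x - d))) \<le> 0"
      using 3 d by (intro mult_nonneg_nonpos) (auto simp: u_def v_def)
    ultimately show ?thesis by linarith
  qed
qed


lemma Fubini_plane:
  fixes g :: "real \<times> real \<Rightarrow> real"
  assumes "integrable lborel g"
  shows "integrable lborel (\<lambda>t. LINT x|lborel. g (x, t))"
    and "(LINT p|lborel. g p) = (LINT t|lborel. LINT x|lborel. g (x, t))"
    and "(LINT p|lborel. g p) = (LINT x|lborel. LINT t|lborel. g (x, t))"
proof -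
  have i: "integrable (lborel \<Otimes>\<^sub>M lborel) (case_prod (\<lambda>x t. g (x, t)))"
    using assms by (simp add: lborel_prod)
  show "integrable lborel (\<lambda>t. LINT x|lborel. g (x, t))"
    using lborel_pair.integrable_snd[OF i] .
  show "(LINT p|lborel. g p) = (LINT t|lborel. LINT x|lborel. g (x, t))"
    using lborel_pair.integral_snd[OF i] by (simp add: lborel_prod)
  show "(LINT p|lborel. g p) = (LINT x|lborel. LINT t|lborel. g (x, t))"
    using lborel_pair.integral_fst[OF i] by (simp add: lborel_prod)
qed

lemma borel_measurable_coordinates:
  "(fst :: real \<times> real \<Rightarrow> real) \<in> borel_measurable borel"
  "(snd :: real \<times> real \<Rightarrow> real) \<in> borel_measurable borel"
  by (intro borel_measurable_continuous_onI continuous_intros)+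

text \<open>The minimiser of \<open>f v - \<xi> v\<close> over \<open>{a..b}\<close> is the Riemann solution for \<open>a \<le> b\<close>: it selects
  the points at which \<open>f\<close> meets its lower convex envelope, without that envelope being constructed.  At the at
  most countably many \<open>\<xi>\<close> with several minimisers (the speeds of shocks) any choice will do.\<close>

locale riemann_minimiser =
  fixes f :: "real \<Rightarrow> real" and a b :: real and w :: "real \<Rightarrow> real"
  assumes continuous_flux: "continuous_on UNIV f"
    and range: "\<And>\<xi>. w \<xi> \<in> {a..b}"
    and minimal: "\<And>\<xi> v. v \<in> {a..b} \<Longrightarrow> f (w \<xi>) - \<xi> * w \<xi> \<le> f v - \<xi> * v"
begin

lemma w_measurable [measurable]: "w \<in> borel_measurable borel"
  using minimiser_mono[of w "{a..b}" f] range minimal by (intro borel_measurable_mono) auto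

lemma f_measurable [measurable]: "f \<in> borel_measurable borel"
  using continuous_flux by (rule borel_measurable_continuous_onI)

lemma ends: "a \<in> {a..b}" "b \<in> {a..b}"
  using range[of 0] by auto

lemma entropy_pair_bounds:
  obtains F where "F > 0" "\<And>\<xi>. \<bar>w \<xi> - k\<bar> \<le> F" "\<And>\<xi>. \<bar>w \<xi>\<bar> \<le> F"
    "\<And>\<xi>. \<bar>sgn (w \<xi> - k) * (f (w \<xi>) - f k)\<bar> \<le> F"
    "\<And>v v'. v \<in> {a..b} \<Longrightarrow> v' \<in> {a..b} \<Longrightarrow> \<bar>f v - f v'\<bar> \<le> F"
proof -
  have "bounded (f ` {a..b})"
    using continuous_flux by (meson compact_Icc compact_continuous_image compact_imp_bounded continuous_on_subset subset_UNIV)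
  then obtain B where B: "B > 0" "\<And>v. v \<in> {a..b} \<Longrightarrow> \<bar>f v\<bar> \<le> B"
    by (auto simp: bounded_pos)
  define F where "F = \<bar>a\<bar> + \<bar>b\<bar> + \<bar>k\<bar> + \<bar>f k\<bar> + 2 * B"
  have wb: "\<bar>w \<xi>\<bar> \<le> \<bar>a\<bar> + \<bar>b\<bar>" for \<xi> using range[of \<xi>] by auto
  show ?thesis
  proof (rule that[of F])
    show "F > 0" using B(1) by (simp add: F_def add_nonneg_pos)
    show "\<bar>w \<xi> - k\<bar> \<le> F" for \<xi> using wb[of \<xi>] B(1) unfolding F_def by linarith
    show "\<bar>w \<xi>\<bar> \<le> F" for \<xi> using wb[of \<xi>] B(1) unfolding F_def by linarith
    show "\<bar>sgn (w \<xi> - k) * (f (w \<xi>) - f k)\<bar> \<le> F" for \<xi>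
    proof -
      have "\<bar>sgn (w \<xi> - k) * (f (w \<xi>) - f k)\<bar> \<le> \<bar>f (w \<xi>) - f k\<bar>"
        by (simp add: abs_mult sgn_if)
      then show ?thesis using B(2)[OF range[of \<xi>]] B(1) unfolding F_def by linarith
    qed
    show "\<bar>f v - f v'\<bar> \<le> F" if "v \<in> {a..b}" "v' \<in> {a..b}" for v v'
      using B(2)[OF that(1)] B(2)[OF that(2)] unfolding F_def by linarith
  qed
qed

text \<open>For large \<open>\<bar>\<xi>\<bar>\<close> the linear term wins: comparison with the end point shows that the minimiser is
  within \<open>F / \<bar>\<xi>\<bar>\<close> of it.  This is how the solution attains its initial data.\<close>

lemma tends_to_riemann_data:
  assumes "x \<noteq> 0" "\<And>n. 0 < d n" "d \<longlonglongrightarrow> (0::real)"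
  shows "(\<lambda>n. w (x / d n)) \<longlonglongrightarrow> riemann_data a b x"
proof -
  obtain F where F: "\<And>v v'. v \<in> {a..b} \<Longrightarrow> v' \<in> {a..b} \<Longrightarrow> \<bar>f v - f v'\<bar> \<le> F"
    using entropy_pair_bounds[of 0] by metis
  have "\<bar>x\<bar> * \<bar>w (x / d n) - riemann_data a b x\<bar> \<le> d n * F" for n
  proof -
    let ?v = "w (x / d n)" and ?u = "riemann_data a b x"
    have u: "?u \<in> {a..b}" using ends by (auto simp: riemann_data_def)
    have v: "?v \<in> {a..b}" by (rule range)
    have "\<bar>x\<bar> * \<bar>?v - ?u\<bar> = x * (?u - ?v)"
      using v by (auto simp: riemann_data_def abs_if algebra_simps)
    also have "\<dots> = d n * ((x / d n) * (?u - ?v))" using assms(2)[of n] by simp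
    also have "(x / d n) * (?u - ?v) \<le> f ?u - f ?v"
      using minimal[OF u, of "x / d n"] by (simp add: algebra_simps)
    also have "f ?u - f ?v \<le> F" using F[OF u v] by simp
    finally show ?thesis using assms(2)[of n] by simp
  qed
  then have le: "norm (w (x / d n) - riemann_data a b x) \<le> d n * (F / \<bar>x\<bar>)" for n
    using assms(1) by (simp add: field_simps)
  have lim: "(\<lambda>n. d n * (F / \<bar>x\<bar>)) \<longlonglongrightarrow> 0"
    by (rule tendsto_mult_left_zero[OF assms(3)])
  have "(\<lambda>n. w (x / d n) - riemann_data a b x) \<longlonglongrightarrow> 0"
    by (rule Lim_null_comparison[OF _ lim]) (rule always_eventually, rule allI, rule le)
  then show ?thesis by (rule LIM_zero_cancel)
qed

text \<open>At a fixed time, the substitution \<open>x = \<xi> t\<close> splits the entropy integrand into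
  \<open>\<bar>w \<xi> - k\<bar> \<partial>\<^sub>t (t \<phi>(\<xi> t, t))\<close>, which is the left-hand side, and a remainder whose integral
  is nonnegative by the decrement estimate.\<close>

lemma time_slice_inequality:
  assumes tf: "test_function \<phi> \<phi>x \<phi>t" and t: "0 < t"
  shows "(LINT \<xi>|lborel. \<bar>w \<xi> - k\<bar> * (\<phi> (\<xi> * t, t) + t * (\<phi>x (\<xi> * t, t) * \<xi> + \<phi>t (\<xi> * t, t))))
    \<le> (LINT x|lborel. \<bar>w (x / t) - k\<bar> * \<phi>t (x, t) + sgn (w (x / t) - k) * (f (w (x / t)) - f k) * \<phi>x (x, t))"
proof -
  define \<eta> where "\<eta> \<xi> = \<bar>w \<xi> - k\<bar>" for \<xi>
  define q where "q \<xi> = sgn (w \<xi> - k) * (f (w \<xi>) - f k)" for \<xi>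
  define p where "p \<xi> = q \<xi> - \<xi> * \<eta> \<xi>" for \<xi>
  define \<theta> where "\<theta> \<xi> = \<phi> (\<xi> * t, t) + t * (\<phi>x (\<xi> * t, t) * \<xi> + \<phi>t (\<xi> * t, t))" for \<xi>
  obtain F where F: "F > 0" "\<And>\<xi>. \<eta> \<xi> \<le> F" "\<And>\<xi>. \<bar>w \<xi>\<bar> \<le> F" "\<And>\<xi>. \<bar>q \<xi>\<bar> \<le> F"
    unfolding \<eta>_def q_def using entropy_pair_bounds[of k] by metis
  obtain R K where RK: "R > 0" "K > 0" "\<And>p. \<bar>\<phi> p\<bar> \<le> K" "\<And>p. \<bar>\<phi>x p\<bar> \<le> K" "\<And>p. \<bar>\<phi>t p\<bar> \<le> K"
    "\<And>x t. R < \<bar>x\<bar> \<or> R < \<bar>t\<bar> \<Longrightarrow> \<phi> (x, t) = 0 \<and> \<phi>x (x, t) = 0 \<and> \<phi>t (x, t) = 0"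
    using test_functionE[OF tf] by metis
  have nn: "0 \<le> \<phi> p" for p using tf unfolding test_function_def by blast
  have [measurable]: "\<eta> \<in> borel_measurable borel" "q \<in> borel_measurable borel"
    unfolding \<eta>_def[abs_def] q_def[abs_def] by measurable
  have [measurable]: "p \<in> borel_measurable borel" unfolding p_def[abs_def] by measurable
  have line: "continuous_on UNIV (\<lambda>\<xi>. (\<xi> * t, t))" by (intro continuous_intros)
  note cont = test_function_continuous[OF tf, THEN continuous_on_compose2, OF line subset_UNIV]
  have [measurable]: "(\<lambda>\<xi>. \<phi> (\<xi> * t, t)) \<in> borel_measurable borel" "(\<lambda>\<xi>. \<phi>x (\<xi> * t, t)) \<in> borel_measurable borel"
    "(\<lambda>\<xi>. \<phi>t (\<xi> * t, t)) \<in> borel_measurable borel"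
    using cont by (auto intro: borel_measurable_continuous_onI)
  have \<eta>nn: "0 \<le> \<eta> \<xi>" for \<xi> by (simp add: \<eta>_def)
  have \<eta>b: "\<bar>\<eta> \<xi>\<bar> \<le> F" for \<xi> using F(2)[of \<xi>] \<eta>nn[of \<xi>] by simp
  have \<eta>b': "\<bar>\<eta> \<xi>\<bar> \<le> F + F * \<bar>\<xi>\<bar>" for \<xi> using \<eta>b[of \<xi>] F(1) by (simp add: add_increasing2)
  have pb: "\<bar>p \<xi>\<bar> \<le> F + F * \<bar>\<xi>\<bar>" for \<xi>
  proof -
    have "\<bar>\<xi> * \<eta> \<xi>\<bar> \<le> F * \<bar>\<xi>\<bar>"
      unfolding abs_mult using mult_left_mono[OF \<eta>b[of \<xi>], of "\<bar>\<xi>\<bar>"] by (simp add: mult.commute)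
    then show ?thesis unfolding p_def using F(4)[of \<xi>] by linarith
  qed
  have out: "\<phi> (\<xi> * t, t) = 0 \<and> \<phi>x (\<xi> * t, t) = 0 \<and> \<phi>t (\<xi> * t, t) = 0" if "R / t < \<bar>\<xi>\<bar>" for \<xi>
    using that RK(6)[of "\<xi> * t" t] t by (auto simp: field_simps abs_mult)
  have \<theta>b: "\<bar>\<theta> \<xi>\<bar> \<le> K + t * (K * (R / t) + K)" for \<xi>
  proof (cases "R / t < \<bar>\<xi>\<bar>")
    case True
    then show ?thesis using out[OF True] RK(1,2) t by (simp add: \<theta>_def)
  next
    case False
    have "\<bar>\<phi>x (\<xi> * t, t) * \<xi>\<bar> \<le> K * (R / t)"
      unfolding abs_mult using RK(2,4) False by (intro mult_mono) auto
    then have "\<bar>\<phi>x (\<xi> * t, t) * \<xi> + \<phi>t (\<xi> * t, t)\<bar> \<le> K * (R / t) + K"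
      using RK(5)[of "(\<xi> * t, t)"] by linarith
    then have "\<bar>t * (\<phi>x (\<xi> * t, t) * \<xi> + \<phi>t (\<xi> * t, t))\<bar> \<le> t * (K * (R / t) + K)"
      unfolding abs_mult using t by simp
    then show ?thesis unfolding \<theta>_def using RK(3)[of "(\<xi> * t, t)"] by linarith
  qed
  have i1: "integrable lborel (\<lambda>\<xi>. p \<xi> * (t * \<phi>x (\<xi> * t, t)))"
    using out F(1) RK(4) t
    by (intro integrable_mult_compact_support[OF _ _ pb, where R = "R / t" and K = "t * K"]) (auto simp: abs_mult)
  have i2: "integrable lborel (\<lambda>\<xi>. \<eta> \<xi> * \<phi> (\<xi> * t, t))"
    using out F(1) RK(3)
    by (intro integrable_mult_compact_support[OF _ _ \<eta>b', where R = "R / t" and K = K]) auto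
  have i3: "integrable lborel (\<lambda>\<xi>. \<eta> \<xi> * \<theta> \<xi>)"
  proof (rule integrable_mult_compact_support[OF _ _ \<eta>b' _ \<theta>b])
    show "\<theta> \<in> borel_measurable borel" unfolding \<theta>_def[abs_def] by measurable
    show "\<theta> \<xi> = 0" if "R / t < \<bar>\<xi>\<bar>" for \<xi> using out[OF that] by (simp add: \<theta>_def)
  qed (use F(1) in auto)
  have pos: "0 \<le> (LINT \<xi>|lborel. p \<xi> * (t * \<phi>x (\<xi> * t, t)) - \<eta> \<xi> * \<phi> (\<xi> * t, t))"
  proof (rule weak_inequality_from_increments[where w = w and A = F and B = F and W = F and R = "R / t"
        and K = "max K (t * K)"])
    show "d * (\<eta> x - (w x - w (x - d))) \<le> p (x - d) - p x" if "0 < d" for x d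
      using minimiser_entropy_increment[of w "{a..b}" f d x k, OF range minimal _ that]
      by (simp add: p_def q_def \<eta>_def)
    show "((\<lambda>\<xi>. \<phi> (\<xi> * t, t)) has_real_derivative t * \<phi>x (x * t, t)) (at x)" for x
      using test_function_curve[OF tf DERIV_cmult_right[OF DERIV_ident] DERIV_const, of t t x]
      by (simp add: mult.commute)
    show "continuous_on UNIV (\<lambda>\<xi>. t * \<phi>x (\<xi> * t, t))" using cont by (intro continuous_intros)
    show "\<bar>t * \<phi>x (x * t, t)\<bar> \<le> max K (t * K)" for x
      using RK(4)[of "(x * t, t)"] t by (simp add: abs_mult le_max_iff_disj)
    show "\<phi> (x * t, t) \<le> max K (t * K)" for x
      using abs_le_D1[OF RK(3)] by (simp add: le_max_iff_disj)
    show "\<phi> (x * t, t) = 0 \<and> t * \<phi>x (x * t, t) = 0" if "R / t < \<bar>x\<bar>" for x using out[OF that] by simp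
  qed (use F nn pb \<eta>b in auto)
  have "(LINT \<xi>|lborel. \<eta> \<xi> * \<theta> \<xi>)
      \<le> (LINT \<xi>|lborel. \<eta> \<xi> * \<theta> \<xi>) + (LINT \<xi>|lborel. p \<xi> * (t * \<phi>x (\<xi> * t, t)) - \<eta> \<xi> * \<phi> (\<xi> * t, t))"
    using pos by simp
  also have "\<dots> = (LINT \<xi>|lborel. \<eta> \<xi> * \<theta> \<xi> + (p \<xi> * (t * \<phi>x (\<xi> * t, t)) - \<eta> \<xi> * \<phi> (\<xi> * t, t)))"
    using i1 i2 i3 by (intro Bochner_Integration.integral_add[symmetric] Bochner_Integration.integrable_diff)
  also have "\<dots> = (LINT \<xi>|lborel. t * (\<eta> \<xi> * \<phi>t (t * \<xi>, t) + q \<xi> * \<phi>x (t * \<xi>, t)))"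
    by (intro Bochner_Integration.integral_cong) (auto simp: p_def \<theta>_def algebra_simps)
  also have "\<dots> = (LINT x|lborel. \<eta> (x / t) * \<phi>t (x, t) + q (x / t) * \<phi>x (x, t))"
    using t lborel_integral_real_affine[of t "\<lambda>x. \<eta> (x / t) * \<phi>t (x, t) + q (x / t) * \<phi>x (x, t)" 0] by simp
  finally show ?thesis by (simp add: \<eta>_def q_def \<theta>_def)
qed


text \<open>Integrating the time slices over \<open>t > \<epsilon>\<close>: along each ray \<open>x = \<xi> t\<close> the lower bound is an exact
  derivative, so only its value at \<open>t = \<epsilon>\<close> is left.  Staying away from \<open>t = 0\<close> keeps the support bounded in
  \<open>\<xi>\<close>.\<close>

lemma truncated_entropy_inequality:
  fixes k :: real
  assumes tf: "test_function \<phi> \<phi>x \<phi>t" and \<epsilon>: "0 < \<epsilon>"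
  defines "E \<equiv> \<lambda>p. \<bar>w (fst p / snd p) - k\<bar> * \<phi>t p + sgn (w (fst p / snd p) - k) * (f (w (fst p / snd p)) - f k) * \<phi>x p"
  shows "integrable lborel E"
    and "- (LINT x|lborel. \<bar>w (x / \<epsilon>) - k\<bar> * \<phi> (x, \<epsilon>)) \<le> (LINT p|lborel. indicator (UNIV \<times> {\<epsilon><..}) p * E p)"
proof -
  obtain F where F: "F > 0" "\<And>\<xi>. \<bar>w \<xi> - k\<bar> \<le> F" "\<And>\<xi>. \<bar>sgn (w \<xi> - k) * (f (w \<xi>) - f k)\<bar> \<le> F"
    using entropy_pair_bounds[of k] by metis
  obtain R K where RK: "R > 0" "K > 0" "\<And>p. \<bar>\<phi> p\<bar> \<le> K" "\<And>p. \<bar>\<phi>x p\<bar> \<le> K" "\<And>p. \<bar>\<phi>t p\<bar> \<le> K"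
    "\<And>x t. R < \<bar>x\<bar> \<or> R < \<bar>t\<bar> \<Longrightarrow> \<phi> (x, t) = 0 \<and> \<phi>x (x, t) = 0 \<and> \<phi>t (x, t) = 0"
    using test_functionE[OF tf] by metis
  note [measurable] = test_function_measurable[OF tf] borel_measurable_coordinates
  have box: "compact (cbox (- r, - r) (r, r :: real))" for r by simp
  have outside: "r < \<bar>x\<bar> \<or> r < \<bar>t\<bar>" if "(x, t) \<notin> cbox (- r, - r) (r, r :: real)" for r x t
    using that by (auto simp: cbox_Pair_eq)
  have inside: "\<bar>x\<bar> \<le> r \<and> \<bar>t\<bar> \<le> r" if "(x, t) \<in> cbox (- r, - r) (r, r :: real)" for r x t
    using that by (auto simp: cbox_Pair_eq)
  show iE: "integrable lborel E"
  proof (rule integrable_bounded_support[OF _ box])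
    show "E \<in> borel_measurable borel" unfolding E_def by measurable
    show "\<bar>E p\<bar> \<le> F * K + F * K" for p
    proof -
      have 1: "\<bar>\<bar>w (fst p / snd p) - k\<bar> * \<phi>t p\<bar> \<le> F * K"
        unfolding abs_mult using F(1,2) RK(5) by (intro mult_mono) (simp_all del: split_paired_All)
      have 2: "\<bar>sgn (w (fst p / snd p) - k) * (f (w (fst p / snd p)) - f k) * \<phi>x p\<bar> \<le> F * K"
        unfolding abs_mult[of _ "\<phi>x p"] by (intro mult_mono F(3) RK(4)) (use F(1) in auto)
      show ?thesis unfolding E_def using 1 2 by linarith
    qed
    show "E p = 0" if "p \<notin> cbox (-R, -R) (R, R)" for p
      using that outside[of "fst p" "snd p" R] RK(6)[of "fst p" "snd p"] by (auto simp: E_def)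
  qed
  define \<theta> where "\<theta> \<xi> t = \<phi> (\<xi> * t, t) + t * (\<phi>x (\<xi> * t, t) * \<xi> + \<phi>t (\<xi> * t, t))" for \<xi> t
  define G where "G p = indicator {\<epsilon><..} (snd p) * (\<bar>w (fst p) - k\<bar> * \<theta> (fst p) (snd p))" for p
  define r where "r = max R (R / \<epsilon>)"
  have Gout: "G (\<xi>, t) = 0" if "R / \<epsilon> < \<bar>\<xi>\<bar> \<or> R < \<bar>t\<bar>" for \<xi> t
  proof (cases "\<epsilon> < t")
    case True
    have "R < \<bar>\<xi> * t\<bar> \<or> R < \<bar>t\<bar>"
    proof (rule disjE[OF that])
      assume "R / \<epsilon> < \<bar>\<xi>\<bar>"
      then have "R < \<bar>\<xi>\<bar> * \<epsilon>" using \<epsilon> by (simp add: field_simps)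
      also have "\<dots> \<le> \<bar>\<xi>\<bar> * \<bar>t\<bar>" using True by (intro mult_left_mono) auto
      finally show ?thesis by (simp add: abs_mult)
    qed simp
    then show ?thesis using RK(6)[of "\<xi> * t" t] by (simp add: G_def \<theta>_def)
  qed (simp add: G_def)
  have iG: "integrable lborel G"
  proof (rule integrable_bounded_support[OF _ box])
    show "G \<in> borel_measurable borel" unfolding G_def[abs_def] \<theta>_def by measurable
    show "\<bar>G p\<bar> \<le> F * (K + r * (K * r + K))" if p: "p \<in> cbox (- r, - r) (r, r)" for p
    proof -
      obtain \<xi> t where [simp]: "p = (\<xi>, t)" by (cases p)
      have b: "\<bar>\<xi>\<bar> \<le> r" "\<bar>t\<bar> \<le> r" using inside[of \<xi> t r] p by auto
      have "\<bar>\<phi>x (\<xi> * t, t) * \<xi>\<bar> \<le> K * r"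
        unfolding abs_mult using RK(2,4) b by (intro mult_mono) auto
      then have "\<bar>\<phi>x (\<xi> * t, t) * \<xi> + \<phi>t (\<xi> * t, t)\<bar> \<le> K * r + K"
        using RK(5)[of "(\<xi> * t, t)"] by linarith
      then have "\<bar>t * (\<phi>x (\<xi> * t, t) * \<xi> + \<phi>t (\<xi> * t, t))\<bar> \<le> r * (K * r + K)"
        unfolding abs_mult using b by (intro mult_mono) auto
      then have "\<bar>\<theta> \<xi> t\<bar> \<le> K + r * (K * r + K)"
        unfolding \<theta>_def using RK(3)[of "(\<xi> * t, t)"] by linarith
      then have "\<bar>w \<xi> - k\<bar> * \<bar>\<theta> \<xi> t\<bar> \<le> F * (K + r * (K * r + K))"
        using F(1) by (intro mult_mono F(2)) auto
      moreover have "\<bar>G p\<bar> \<le> \<bar>w \<xi> - k\<bar> * \<bar>\<theta> \<xi> t\<bar>"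
        by (simp add: G_def indicator_def abs_mult)
      ultimately show ?thesis by linarith
    qed
    show "G p = 0" if "p \<notin> cbox (- r, - r) (r, r)" for p
      using that outside[of "fst p" "snd p" r] Gout[of "fst p" "snd p"] by (auto simp: r_def)
  qed
  have ray: "(LINT t|lborel. G (\<xi>, t)) = - (\<bar>w \<xi> - k\<bar> * (\<epsilon> * \<phi> (\<xi> * \<epsilon>, \<epsilon>)))" for \<xi>
  proof -
    have "(LINT t|lborel. indicator {\<epsilon><..} t * \<theta> \<xi> t) = - (\<epsilon> * \<phi> (\<xi> * \<epsilon>, \<epsilon>))"
    proof (rule LINT_halfline_derivative[where R = R])
      show "((\<lambda>t. t * \<phi> (\<xi> * t, t)) has_real_derivative \<theta> \<xi> t) (at t)" for t
        using DERIV_mult[OF DERIV_ident test_function_curve[OF tf DERIV_cmult[OF DERIV_ident] DERIV_ident], of \<xi> t]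
        by (simp add: \<theta>_def algebra_simps)
      have ray: "continuous_on UNIV (\<lambda>t. (\<xi> * t, t))" by (intro continuous_intros)
      note cont = test_function_continuous[OF tf, THEN continuous_on_compose2, OF ray subset_UNIV]
      show "continuous_on UNIV (\<theta> \<xi>)"
        unfolding \<theta>_def by (intro continuous_intros cont)
      show "t * \<phi> (\<xi> * t, t) = 0 \<and> \<theta> \<xi> t = 0" if "R < t" for t
        using that RK(1) RK(6)[of "\<xi> * t" t] by (simp add: \<theta>_def)
    qed
    then have "\<bar>w \<xi> - k\<bar> * (LINT t|lborel. indicator {\<epsilon><..} t * \<theta> \<xi> t) = - (\<bar>w \<xi> - k\<bar> * (\<epsilon> * \<phi> (\<xi> * \<epsilon>, \<epsilon>)))"
      by simp
    also have "\<bar>w \<xi> - k\<bar> * (LINT t|lborel. indicator {\<epsilon><..} t * \<theta> \<xi> t) = (LINT t|lborel. G (\<xi>, t))"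
      unfolding integral_mult_right_zero[symmetric]
      by (intro Bochner_Integration.integral_cong) (auto simp: G_def)
    finally show ?thesis .
  qed
  have iE': "integrable lborel (\<lambda>p. indicator (UNIV \<times> {\<epsilon><..}) p * E p)"
    using integrable_real_mult_indicator[OF _ iE, of "UNIV \<times> {\<epsilon><..}"] by (simp add: mult.commute borel_Times)
  have "- (LINT x|lborel. \<bar>w (x / \<epsilon>) - k\<bar> * \<phi> (x, \<epsilon>)) = (LINT \<xi>|lborel. - (\<bar>w \<xi> - k\<bar> * (\<epsilon> * \<phi> (\<xi> * \<epsilon>, \<epsilon>))))"
    using \<epsilon> lborel_integral_real_affine[of \<epsilon> "\<lambda>x. \<bar>w (x / \<epsilon>) - k\<bar> * \<phi> (x, \<epsilon>)" 0]
    by (simp add: mult_ac)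
  also have "\<dots> = (LINT p|lborel. G p)"
    unfolding Fubini_plane(3)[OF iG] ray ..
  also have "\<dots> = (LINT t|lborel. LINT \<xi>|lborel. G (\<xi>, t))"
    by (rule Fubini_plane(2)[OF iG])
  also have "\<dots> \<le> (LINT t|lborel. LINT x|lborel. indicator (UNIV \<times> {\<epsilon><..}) (x, t) * E (x, t))"
  proof (rule integral_mono[OF Fubini_plane(1)[OF iG] Fubini_plane(1)[OF iE']])
    fix t :: real
    show "(LINT \<xi>|lborel. G (\<xi>, t)) \<le> (LINT x|lborel. indicator (UNIV \<times> {\<epsilon><..}) (x, t) * E (x, t))"
    proof (cases "\<epsilon> < t")
      case True
      with \<epsilon> time_slice_inequality[OF tf, of t k] show ?thesis
        by (simp add: G_def E_def \<theta>_def indicator_def)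
    qed (simp add: G_def indicator_def)
  qed
  also have "\<dots> = (LINT p|lborel. indicator (UNIV \<times> {\<epsilon><..}) p * E p)"
    by (rule Fubini_plane(2)[OF iE', symmetric])
  finally show "- (LINT x|lborel. \<bar>w (x / \<epsilon>) - k\<bar> * \<phi> (x, \<epsilon>)) \<le> (LINT p|lborel. indicator (UNIV \<times> {\<epsilon><..}) p * E p)" .
qed

lemma self_similar_entropy_solution:
  assumes "{a..b} \<subseteq> I"
  shows "entropy_solution f I (riemann_data a b) (\<lambda>(x, t). w (x / t))"
  unfolding entropy_solution_def
proof (intro conjI ballI allI impI)
  note [measurable] = borel_measurable_coordinates
  have um: "(\<lambda>p::real \<times> real. w (fst p / snd p)) \<in> borel_measurable borel" by measurable
  then show "set_borel_measurable borel (UNIV \<times> {0<..}) (\<lambda>(x, t). w (x / t))"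
    unfolding set_borel_measurable_def case_prod_beta
    by (intro borel_measurable_scaleR borel_measurable_indicator) (auto simp: borel_Times)
  show "(case (x, t) of (x, t) \<Rightarrow> w (x / t)) \<in> I" for x t
    using range assms by auto
  fix k \<phi> \<phi>x \<phi>t assume tf: "test_function \<phi> \<phi>x \<phi>t"
  define E where "E p = \<bar>w (fst p / snd p) - k\<bar> * \<phi>t p + sgn (w (fst p / snd p) - k) * (f (w (fst p / snd p)) - f k) * \<phi>x p" for p
  have iE: "integrable lborel E" and
    ineq: "- (LINT x|lborel. \<bar>w (x / \<epsilon>) - k\<bar> * \<phi> (x, \<epsilon>)) \<le> (LINT p|lborel. indicator (UNIV \<times> {\<epsilon><..}) p * E p)"
    if "0 < \<epsilon>" for \<epsilon>
    using truncated_entropy_inequality[OF tf, of _ k] that unfolding E_def[abs_def] by (blast intro: zero_less_one)+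
  have iE: "integrable lborel E" using iE[of 1] by simp
  obtain F where F: "F > 0" "\<And>\<xi>. \<bar>w \<xi> - k\<bar> \<le> F" using entropy_pair_bounds[of k] by metis
  obtain R K where RK: "R > 0" "K > 0" "\<And>p. \<bar>\<phi> p\<bar> \<le> K"
    "\<And>x t. R < \<bar>x\<bar> \<or> R < \<bar>t\<bar> \<Longrightarrow> \<phi> (x, t) = 0"
    using test_functionE[OF tf] by metis
  define d where "d n = 1 / real (Suc n)" for n
  have d: "0 < d n" for n by (simp add: d_def)
  have dlim: "d \<longlonglongrightarrow> 0"
    unfolding d_def using LIMSEQ_inverse_real_of_nat by (simp add: inverse_eq_divide)
  have lim1: "(\<lambda>n. LINT p|lborel. indicator (UNIV \<times> {d n<..}) p * E p)
      \<longlonglongrightarrow> (LINT p|lborel. indicator (UNIV \<times> {0<..}) p * E p)"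
  proof (rule integral_dominated_convergence[where w = "\<lambda>p. \<bar>E p\<bar>"])
    have [measurable]: "E \<in> borel_measurable borel" using iE by simp
    have [measurable]: "UNIV \<times> {c::real<..} \<in> sets (borel :: (real \<times> real) measure)" for c
      by (auto simp: borel_Times)
    show "(\<lambda>p. indicator (UNIV \<times> {0<..}) p * E p) \<in> borel_measurable lborel"
      "\<And>n. (\<lambda>p. indicator (UNIV \<times> {d n<..}) p * E p) \<in> borel_measurable lborel" by measurable
    show "integrable lborel (\<lambda>p. \<bar>E p\<bar>)" using iE by simp
    show "AE p in lborel. (\<lambda>n. indicator (UNIV \<times> {d n<..}) p * E p) \<longlonglongrightarrow> indicator (UNIV \<times> {0<..}) p * E p"
    proof (intro AE_I2)
      fix p :: "real \<times> real"
      show "(\<lambda>n. indicator (UNIV \<times> {d n<..}) p * E p) \<longlonglongrightarrow> indicator (UNIV \<times> {0<..}) p * E p"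
      proof (cases "0 < snd p")
        case True
        have "eventually (\<lambda>n. d n < snd p) sequentially" using order_tendstoD(2)[OF dlim True] .
        then have "eventually (\<lambda>n. indicator (UNIV \<times> {d n<..}) p * E p = indicator (UNIV \<times> {0<..}) p * E p) sequentially"
          by (rule eventually_mono) (use True in \<open>auto simp: indicator_def mem_Times_iff\<close>)
        then show ?thesis by (rule tendsto_eventually)
      next
        case False
        then have eq: "indicator (UNIV \<times> {d n<..}) p * E p = indicator (UNIV \<times> {0<..}) p * E p" for n
          using d[of n] by (auto simp: indicator_def mem_Times_iff)
        show ?thesis unfolding eq by (rule tendsto_const)
      qed
    qed
    show "\<And>n. AE p in lborel. norm (indicator (UNIV \<times> {d n<..}) p * E p) \<le> \<bar>E p\<bar>"
      by (auto simp: indicator_def)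
  qed
  have lim2: "(\<lambda>n. LINT x|lborel. \<bar>w (x / d n) - k\<bar> * \<phi> (x, d n))
      \<longlonglongrightarrow> (LINT x|lborel. \<bar>riemann_data a b x - k\<bar> * \<phi> (x, 0))"
  proof (rule integral_dominated_convergence[where w = "\<lambda>x. indicator {-R..R} x * (F * K)"])
    note c = test_function_continuous(1)[OF tf, THEN continuous_on_compose2, OF _ subset_UNIV]
    have [measurable]: "(\<lambda>x. \<phi> (x, t)) \<in> borel_measurable borel" for t
      by (intro borel_measurable_continuous_onI c continuous_intros)
    have [measurable]: "riemann_data a b \<in> borel_measurable borel"
      unfolding riemann_data_def[abs_def] by measurable
    show "(\<lambda>x. \<bar>riemann_data a b x - k\<bar> * \<phi> (x, 0)) \<in> borel_measurable lborel"
      "\<And>n. (\<lambda>x. \<bar>w (x / d n) - k\<bar> * \<phi> (x, d n)) \<in> borel_measurable lborel" by measurable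
    show "integrable lborel (\<lambda>x. indicator {-R..R} x * (F * K))"
      by (intro integrable_mult_left integrable_real_indicator) (auto simp: emeasure_lborel_Icc_eq)
    show "AE x in lborel. (\<lambda>n. \<bar>w (x / d n) - k\<bar> * \<phi> (x, d n)) \<longlonglongrightarrow> \<bar>riemann_data a b x - k\<bar> * \<phi> (x, 0)"
      using AE_lborel_singleton[of 0]
    proof eventually_elim
      case (elim x)
      have "isCont \<phi> (x, 0)"
        using test_function_continuous(1)[OF tf] by (simp add: continuous_on_eq_continuous_at)
      then have "(\<lambda>n. \<phi> (x, d n)) \<longlonglongrightarrow> \<phi> (x, 0)"
        by (rule isCont_tendsto_compose) (intro tendsto_intros dlim)
      then show ?case
        by (intro tendsto_intros tends_to_riemann_data elim d dlim)
    qed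
    show "AE x in lborel. norm (\<bar>w (x / d n) - k\<bar> * \<phi> (x, d n)) \<le> indicator {-R..R} x * (F * K)" for n
    proof (intro AE_I2)
      fix x
      show "norm (\<bar>w (x / d n) - k\<bar> * \<phi> (x, d n)) \<le> indicator {-R..R} x * (F * K)"
      proof (cases "R < \<bar>x\<bar>")
        case True
        then show ?thesis using F(1) RK(2) RK(4)[of x "d n"] by (simp add: indicator_def)
      next
        case False
        have "\<bar>w (x / d n) - k\<bar> * \<bar>\<phi> (x, d n)\<bar> \<le> F * K"
          using F RK by (intro mult_mono) auto
        with False show ?thesis by (auto simp: abs_mult indicator_def abs_le_iff)
      qed
    qed
  qed
  have "0 \<le> (LINT p|lborel. indicator (UNIV \<times> {0<..}) p * E p) + (LINT x|lborel. \<bar>riemann_data a b x - k\<bar> * \<phi> (x, 0))"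
  proof (rule LIMSEQ_le_const[OF tendsto_add[OF lim1 lim2]], intro exI allI impI)
    show "0 \<le> (LINT p|lborel. indicator (UNIV \<times> {d n<..}) p * E p) + (LINT x|lborel. \<bar>w (x / d n) - k\<bar> * \<phi> (x, d n))" for n
      using ineq[OF d, of n] by linarith
  qed
  then show "0 \<le> (LINT p:(UNIV \<times> {0<..})|lborel.
               \<bar>(case p of (x, t) \<Rightarrow> w (x / t)) - k\<bar> * \<phi>t p
               + sgn ((case p of (x, t) \<Rightarrow> w (x / t)) - k) * (f (case p of (x, t) \<Rightarrow> w (x / t)) - f k) * \<phi>x p)
           + (LINT x|lborel. \<bar>riemann_data a b x - k\<bar> * \<phi> (x, 0))"
    unfolding set_lebesgue_integral_def by (simp add: E_def case_prod_beta)
qed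

end


section \<open>Existence of solutions without positive speeds\<close>

lemma ex_riemann_minimiser:
  assumes "continuous_on UNIV f" "a \<le> b"
  obtains w where "riemann_minimiser f a b w"
proof -
  have "\<exists>u\<in>{a..b}. \<forall>v\<in>{a..b}. f u - \<xi> * u \<le> f v - \<xi> * v" for \<xi>
    using assms by (intro continuous_attains_inf continuous_intros) (auto intro: continuous_on_subset)
  then obtain w where "\<And>\<xi>. w \<xi> \<in> {a..b}" "\<And>\<xi> v. v \<in> {a..b} \<Longrightarrow> f (w \<xi>) - \<xi> * w \<xi> \<le> f v - \<xi> * v"
    by metis
  with assms(1) have "riemann_minimiser f a b w" by unfold_locales auto
  with that show ?thesis by blast
qed

text \<open>Upstream admissibility in terms of densities, for an arbitrary flux: \<open>a\<close> is the state far away from the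
  boundary \<open>\<xi> = 0\<close> and \<open>b\<close> the state attained there.\<close>

definition left_wave :: "(real \<Rightarrow> real) \<Rightarrow> real set \<Rightarrow> real \<Rightarrow> real \<Rightarrow> (real \<Rightarrow> real) \<Rightarrow> bool" where
  "left_wave f I a b w \<longleftrightarrow>
     entropy_solution f I (riemann_data a b) (\<lambda>(x, t). w (x / t)) \<and>
     w constant_on {0<..} \<and> (w \<longlongrightarrow> b) (at_left 0)"

text \<open>Since \<open>f b\<close> is a strict minimum of \<open>f\<close> over \<open>{a..b}\<close>, the tilted flux with a nonnegative slope is
  minimal at \<open>b\<close> only, and for a small negative slope its minimisers are close to \<open>b\<close>.\<close>

lemma left_wave_exists:
  assumes f: "continuous_on UNIV f" and ab: "a \<le> b" "{a..b} \<subseteq> I"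
    and strict: "\<And>k. a \<le> k \<Longrightarrow> k < b \<Longrightarrow> f b < f k"
  shows "\<exists>w. left_wave f I a b w"
proof -
  obtain w where "riemann_minimiser f a b w" using ex_riemann_minimiser[OF f ab(1)] .
  then interpret riemann_minimiser f a b w .
  have pos: "w \<xi> = b" if "0 < \<xi>" for \<xi>
  proof (rule ccontr)
    assume "w \<xi> \<noteq> b"
    then have "a \<le> w \<xi>" "w \<xi> < b" using range[of \<xi>] by auto
    moreover from this have "\<xi> * w \<xi> \<le> \<xi> * b" using that by (intro mult_left_mono) auto
    ultimately show False using minimal[of b \<xi>] ab strict[of "w \<xi>"] by auto
  qed
  have "(w \<longlongrightarrow> b) (at_left 0)"
  proof (rule order_tendstoI)
    fix y assume "b < y"
    then show "eventually (\<lambda>\<xi>. w \<xi> < y) (at_left 0)"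
      using range by (intro always_eventually) (metis atLeastAtMost_iff le_less_trans)
  next
    fix y assume y: "y < b"
    show "eventually (\<lambda>\<xi>. y < w \<xi>) (at_left 0)"
    proof (cases "a \<le> y")
      case False
      then show ?thesis using range by (intro always_eventually) (metis atLeastAtMost_iff less_le_trans not_le)
    next
      case True
      \<comment> \<open>On \<open>{a..y}\<close> the flux stays a definite amount above \<open>f b\<close>, which a small slope cannot make up for.\<close>
      have "\<exists>u\<in>{a..y}. \<forall>v\<in>{a..y}. f u \<le> f v"
        using f True by (intro continuous_attains_inf) (auto intro: continuous_on_subset)
      then obtain u where u: "u \<in> {a..y}" "\<And>v. v \<in> {a..y} \<Longrightarrow> f u \<le> f v" by blast
      define \<delta> where "\<delta> = (f u - f b) / (b - a)"
      have "f b < f u" using strict[of u] u(1) y by auto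
      then have \<delta>: "\<delta> > 0" "\<delta> * (b - a) = f u - f b" using True y by (auto simp: \<delta>_def)
      have "y < w \<xi>" if "- \<delta> < \<xi>" "\<xi> < 0" for \<xi>
      proof (rule ccontr)
        assume "\<not> y < w \<xi>"
        then have "f u \<le> f (w \<xi>)" using u(2)[of "w \<xi>"] range[of \<xi>] by auto
        moreover have "f (w \<xi>) - \<xi> * w \<xi> \<le> f b - \<xi> * b" by (rule minimal) (rule ends)
        ultimately have "\<delta> * (b - a) \<le> (- \<xi>) * (b - w \<xi>)" unfolding \<delta>(2) by (simp add: algebra_simps)
        also have "\<dots> \<le> (- \<xi>) * (b - a)" using that(2) range[of \<xi>] by (intro mult_left_mono) auto
        also have "\<dots> < \<delta> * (b - a)" using that(1) True y by (intro mult_strict_right_mono) auto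
        finally show False by simp
      qed
      then show ?thesis
        unfolding eventually_at_left_field using \<delta>(1) by (intro exI[of _ "- \<delta>"]) auto
    qed
  qed
  moreover have "w constant_on {0<..}" using pos by (auto simp: constant_on_def)
  ultimately show ?thesis
    unfolding left_wave_def using self_similar_entropy_solution[OF ab(2)] by blast
qed

section \<open>Symmetries of entropy solutions\<close>

lemma entropy_solution_cong_flux:
  assumes "\<And>v. v \<in> I \<Longrightarrow> f v = g v"
  shows "entropy_solution f I u0 u \<longleftrightarrow> entropy_solution g I u0 u"
proof -
  have *: "(LINT p:(UNIV \<times> {0<..})|lborel. \<bar>u p - k\<bar> * \<phi>t p + sgn (u p - k) * (f (u p) - f k) * \<phi>x p)
      = (LINT p:(UNIV \<times> {0<..})|lborel. \<bar>u p - k\<bar> * \<phi>t p + sgn (u p - k) * (g (u p) - g k) * \<phi>x p)"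
    if "\<And>x t. 0 < t \<Longrightarrow> u (x, t) \<in> I" "k \<in> I" for k \<phi>t \<phi>x
    unfolding set_lebesgue_integral_def
    using that assms by (intro Bochner_Integration.integral_cong) (auto simp: indicator_def)
  show ?thesis unfolding entropy_solution_def using * by (simp cong: conj_cong ball_cong)
qed

text \<open>This symmetry exchanges the cases \<open>a \<le> b\<close> and \<open>a > b\<close> of the Riemann problem, that is, lower convex and
  upper concave envelopes.\<close>

lemma entropy_solution_uminus:
  assumes "entropy_solution f I u0 u"
  shows "entropy_solution (\<lambda>v. - f (- v)) (uminus ` I) (\<lambda>x. - u0 x) (\<lambda>p. - u p)"
  unfolding entropy_solution_def
proof (intro conjI ballI allI impI)
  have "set_borel_measurable borel (UNIV \<times> {0<..}) u" using assms by (simp add: entropy_solution_def)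
  then show "set_borel_measurable borel (UNIV \<times> {0<..}) (\<lambda>p. - u p)"
    unfolding set_borel_measurable_def by simp
  show "- u (x, t) \<in> uminus ` I" if "0 < t" for x t
    using assms that by (simp add: entropy_solution_def)
  fix k \<phi> \<phi>x \<phi>t assume k: "k \<in> uminus ` I" and tf: "test_function \<phi> \<phi>x \<phi>t"
  have e1: "\<bar>- v - k\<bar> = \<bar>v - (- k)\<bar>" for v :: real by linarith
  have e2: "sgn (- v - k) * (- f (- (- v)) - - f (- k)) = sgn (v - (- k)) * (f v - f (- k))" for v
    by (simp add: sgn_if)
  show "0 \<le> (LINT p:(UNIV \<times> {0<..})|lborel.
               \<bar>- u p - k\<bar> * \<phi>t p + sgn (- u p - k) * (- f (- (- u p)) - - f (- k)) * \<phi>x p)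
           + (LINT x|lborel. \<bar>- u0 x - k\<bar> * \<phi> (x, 0))"
    unfolding e1 e2 using assms k tf unfolding entropy_solution_def by force
qed

lemma entropy_integrand_measurable:
  fixes u \<phi>x \<phi>t :: "real \<times> real \<Rightarrow> real"
  assumes "set_borel_measurable borel (UNIV \<times> {0<..}) u"
    and [measurable]: "f \<in> borel_measurable borel" "\<phi>x \<in> borel_measurable borel" "\<phi>t \<in> borel_measurable borel"
  shows "(\<lambda>p. indicator (UNIV \<times> {0<..}) p * (\<bar>u p - k\<bar> * \<phi>t p + sgn (u p - k) * (f (u p) - f k) * \<phi>x p))
    \<in> borel_measurable borel"
proof -
  define v where "v p = indicator (UNIV \<times> {0::real<..}) p * u p" for p
  have [measurable]: "v \<in> borel_measurable borel"
    using assms(1) by (simp add: set_borel_measurable_def v_def[abs_def])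
  have [measurable]: "UNIV \<times> {0::real<..} \<in> sets (borel :: (real \<times> real) measure)"
    by (auto simp: borel_Times)
  have "(\<lambda>p. indicator (UNIV \<times> {0<..}) p * (\<bar>v p - k\<bar> * \<phi>t p + sgn (v p - k) * (f (v p) - f k) * \<phi>x p))
    \<in> borel_measurable borel" by measurable
  also have "(\<lambda>p. indicator (UNIV \<times> {0<..}) p * (\<bar>v p - k\<bar> * \<phi>t p + sgn (v p - k) * (f (v p) - f k) * \<phi>x p))
    = (\<lambda>p. indicator (UNIV \<times> {0<..}) p * (\<bar>u p - k\<bar> * \<phi>t p + sgn (u p - k) * (f (u p) - f k) * \<phi>x p))"
    by (auto simp: v_def indicator_def)
  finally show ?thesis .
qed

lemma LINT_plane_reflect:
  fixes g :: "real \<times> real \<Rightarrow> real"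
  assumes "g \<in> borel_measurable borel"
  shows "(LINT p|lborel. g (- fst p, snd p)) = (LINT p|lborel. g p)"
proof -
  note [measurable] = assms borel_measurable_coordinates
  have "distr lborel borel uminus \<Otimes>\<^sub>M distr lborel borel (\<lambda>t::real. t)
      = distr (lborel \<Otimes>\<^sub>M lborel) (borel \<Otimes>\<^sub>M borel) (\<lambda>(x, t). (- x :: real, t))"
    by (rule pair_measure_distr)
      (auto simp: lborel_distr_uminus distr_id2 intro!: lborel.sigma_finite_measure_axioms)
  then have D: "lborel = distr lborel borel (\<lambda>p::real \<times> real. (- fst p, snd p))"
    by (simp add: lborel_distr_uminus distr_id2 lborel_prod borel_prod case_prod_unfold)
  have [measurable]: "(\<lambda>p::real \<times> real. (- fst p, snd p)) \<in> measurable lborel borel"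
    by (simp add: borel_prod[symmetric])
  show ?thesis by (subst (2) D) (subst integral_distr, auto)
qed

lemma test_function_reflect:
  assumes "test_function \<phi> \<phi>x \<phi>t"
  shows "test_function (\<lambda>p. \<phi> (- fst p, snd p)) (\<lambda>p. - \<phi>x (- fst p, snd p)) (\<lambda>p. \<phi>t (- fst p, snd p))"
  unfolding test_function_def
proof (intro conjI allI)
  show "0 \<le> \<phi> (- fst p, snd p)" for p using assms by (simp add: test_function_def)
  have refl: "continuous_on S (\<lambda>p. (- fst p, snd p))" for S :: "(real \<times> real) set"
    by (intro continuous_intros)
  note cont = test_function_continuous[OF assms, THEN continuous_on_compose2, OF refl subset_UNIV]
  show "continuous_on UNIV (\<lambda>p. - \<phi>x (- fst p, snd p))" "continuous_on UNIV (\<lambda>p. \<phi>t (- fst p, snd p))"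
    by (intro continuous_intros cont)+
  show "((\<lambda>p. \<phi> (- fst p, snd p)) has_derivative
      (\<lambda>h. - \<phi>x (- fst p, snd p) * fst h + \<phi>t (- fst p, snd p) * snd h)) (at p)" for p
  proof -
    have "((\<lambda>p. (- fst p, snd p)) has_derivative (\<lambda>h. (- fst h, snd h))) (at p)"
      by (intro derivative_intros)
    moreover have "(\<phi> has_derivative (\<lambda>h. \<phi>x (- fst p, snd p) * fst h + \<phi>t (- fst p, snd p) * snd h)) (at (- fst p, snd p))"
      using assms unfolding test_function_def by blast
    ultimately show ?thesis using has_derivative_compose by fastforce
  qed
  obtain R where R: "\<And>x t. R < \<bar>x\<bar> \<or> R < \<bar>t\<bar> \<Longrightarrow> \<phi> (x, t) = 0"
    using test_functionE[OF assms] by metis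
  have "{p. \<phi> (- fst p, snd p) \<noteq> 0} \<subseteq> cbox (-R, -R) (R, R)"
  proof
    fix p assume "p \<in> {p. \<phi> (- fst p, snd p) \<noteq> 0}"
    then have "\<bar>fst p\<bar> \<le> R" "\<bar>snd p\<bar> \<le> R"
      using R[of "- fst p" "snd p"] by (auto simp: not_less[symmetric])
    then show "p \<in> cbox (-R, -R) (R, R)" by (cases p) (auto simp: cbox_Pair_eq)
  qed
  then show "compact (closure {p. \<phi> (- fst p, snd p) \<noteq> 0})"
    using bounded_subset[OF bounded_cbox] by (simp add: compact_closure)
qed

text \<open>Reflecting space reverses the sign of the flux; this exchanges the upstream and the downstream problem.\<close>

lemma entropy_solution_reflect:
  assumes sol: "entropy_solution f I u0 u" and f: "f \<in> borel_measurable borel"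
  shows "entropy_solution (\<lambda>v. - f v) I (\<lambda>x. u0 (- x)) (\<lambda>(x, t). u (- x, t))"
  unfolding entropy_solution_def
proof (intro conjI ballI allI impI)
  have meas: "set_borel_measurable borel (UNIV \<times> {0<..}) u" using sol by (simp add: entropy_solution_def)
  note [measurable] = borel_measurable_coordinates
  have [measurable]: "(\<lambda>p::real \<times> real. (- fst p, snd p)) \<in> measurable borel borel"
    by (intro borel_measurable_continuous_onI continuous_intros)
  have "(\<lambda>p. indicator (UNIV \<times> {0<..}) p * u p) \<in> borel_measurable borel"
    using meas by (simp add: set_borel_measurable_def)
  from measurable_compose[OF _ this, of "\<lambda>p. (- fst p, snd p)" borel]
  show "set_borel_measurable borel (UNIV \<times> {0<..}) (\<lambda>(x, t). u (- x, t))"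
    by (simp add: set_borel_measurable_def case_prod_beta indicator_def mem_Times_iff)
  show "(case (x, t) of (x, t) \<Rightarrow> u (- x, t)) \<in> I" if "0 < t" for x t
    using sol that by (simp add: entropy_solution_def)
  fix k \<phi> \<phi>x \<phi>t assume k: "k \<in> I" and tf: "test_function \<phi> \<phi>x \<phi>t"
  define g where "g p = indicator (UNIV \<times> {0::real<..}) p *
    (\<bar>u p - k\<bar> * \<phi>t (- fst p, snd p) + sgn (u p - k) * (f (u p) - f k) * (- \<phi>x (- fst p, snd p)))" for p
  note tf' = test_function_reflect[OF tf]
  have g: "g \<in> borel_measurable borel"
    unfolding g_def[abs_def] using test_function_measurable[OF tf'] by (intro entropy_integrand_measurable meas f)
  have "0 \<le> (LINT p|lborel. g p) + (LINT x|lborel. \<bar>u0 x - k\<bar> * \<phi> (- x, 0))"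
    using sol k tf' unfolding entropy_solution_def set_lebesgue_integral_def g_def by force
  also have "(LINT p|lborel. g p) = (LINT p|lborel. g (- fst p, snd p))"
    by (rule LINT_plane_reflect[OF g, symmetric])
  also have "(LINT x|lborel. \<bar>u0 x - k\<bar> * \<phi> (- x, 0)) = (LINT x|lborel. \<bar>u0 (- x) - k\<bar> * \<phi> (x, 0))"
    using lborel_integral_real_affine[of "-1" "\<lambda>x. \<bar>u0 x - k\<bar> * \<phi> (- x, 0)" 0] by simp
  also have "(LINT p|lborel. g (- fst p, snd p)) = (LINT p:(UNIV \<times> {0<..})|lborel.
      \<bar>(case p of (x, t) \<Rightarrow> u (- x, t)) - k\<bar> * \<phi>t p
      + sgn ((case p of (x, t) \<Rightarrow> u (- x, t)) - k) * (- f (case p of (x, t) \<Rightarrow> u (- x, t)) - - f k) * \<phi>x p)"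
    unfolding set_lebesgue_integral_def g_def
    by (intro Bochner_Integration.integral_cong) (auto simp: indicator_def algebra_simps)
  finally show "0 \<le> (LINT p:(UNIV \<times> {0<..})|lborel.
      \<bar>(case p of (x, t) \<Rightarrow> u (- x, t)) - k\<bar> * \<phi>t p
      + sgn ((case p of (x, t) \<Rightarrow> u (- x, t)) - k) * (- f (case p of (x, t) \<Rightarrow> u (- x, t)) - - f k) * \<phi>x p)
      + (LINT x|lborel. \<bar>u0 (- x) - k\<bar> * \<phi> (x, 0))" .
qed


section \<open>Cutoffs for a cone of dependence\<close>

lemma DERIV_square_of_positive_part:
  "((\<lambda>y. (max 0 y)\<^sup>2) has_real_derivative 2 * max 0 y) (at (y :: real))"
proof -
  consider "y < 0" | "y > 0" | "y = 0" by linarith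
  then show ?thesis
  proof cases
    case 1
    have "((\<lambda>y. 0) has_real_derivative 2 * max 0 y) (at y)" using 1 by simp
    then show ?thesis
      by (rule has_field_derivative_transform_within_open[of _ _ _ "{..<0}"]) (use 1 in auto)
  next
    case 2
    have "((\<lambda>y. y\<^sup>2) has_real_derivative 2 * max 0 y) (at y)"
      using 2 by (auto intro!: derivative_eq_intros)
    then show ?thesis
      by (rule has_field_derivative_transform_within_open[of _ _ _ "{0<..}"]) (use 2 in auto)
  next
    case 3
    have "(\<lambda>h::real. ((max 0 h)\<^sup>2) / h) \<midarrow>0\<rightarrow> 0"
    proof (rule Lim_null_comparison[where g = "\<lambda>h. \<bar>h\<bar>"])
      show "eventually (\<lambda>h::real. norm ((max 0 h)\<^sup>2 / h) \<le> \<bar>h\<bar>) (at 0)"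
        by (intro always_eventually) (auto simp: max_def power2_eq_square)
      show "((\<lambda>h::real. \<bar>h\<bar>) \<longlongrightarrow> 0) (at 0)" by (auto intro!: tendsto_eq_intros)
    qed
    then show ?thesis using 3 by (simp add: DERIV_def)
  qed
qed

text \<open>The integral of a hat function over \<open>{0..1}\<close>, hence continuously differentiable and rising from \<open>0\<close> to
  \<open>1\<close> there.\<close>

definition smoothstep :: "real \<Rightarrow> real" where
  "smoothstep y = 2 * ((max 0 y)\<^sup>2 - 2 * (max 0 (y - 1/2))\<^sup>2 + (max 0 (y - 1))\<^sup>2)"

definition smoothstep' :: "real \<Rightarrow> real" where
  "smoothstep' y = 4 * (max 0 y - 2 * max 0 (y - 1/2) + max 0 (y - 1))"

lemma DERIV_smoothstep: "(smoothstep has_real_derivative smoothstep' y) (at y)"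
proof -
  have shift: "((\<lambda>y. (max 0 (y - c))\<^sup>2) has_real_derivative 2 * max 0 (y - c)) (at y)" for c
    using DERIV_shift[of "\<lambda>y. (max 0 y)\<^sup>2" _ y "- c"] DERIV_square_of_positive_part[of "y - c"] by simp
  show ?thesis
    unfolding smoothstep_def[abs_def] smoothstep'_def
    using DERIV_cmult[OF DERIV_add[OF DERIV_diff[OF shift[of 0] DERIV_cmult[OF shift[of "1/2"], of 2]] shift[of 1]], of 2]
    by (simp add: algebra_simps)
qed

lemma continuous_smoothstep':
  "continuous_on S g \<Longrightarrow> continuous_on S (\<lambda>p. smoothstep' (g p))"
  unfolding smoothstep'_def by (intro continuous_intros)

lemma continuous_smoothstep:
  "continuous_on S g \<Longrightarrow> continuous_on S (\<lambda>p. smoothstep (g p))"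
  unfolding smoothstep_def by (intro continuous_intros)

lemma smoothstep_left: "y \<le> 0 \<Longrightarrow> smoothstep y = 0" "y \<le> 0 \<Longrightarrow> smoothstep' y = 0"
  by (auto simp: smoothstep_def smoothstep'_def)

lemma smoothstep_right: "1 \<le> y \<Longrightarrow> smoothstep y = 1" "1 \<le> y \<Longrightarrow> smoothstep' y = 0"
  by (auto simp: smoothstep_def smoothstep'_def power2_eq_square field_simps)

lemma smoothstep'_bounds: "0 \<le> smoothstep' y" "smoothstep' y \<le> 2 * indicator {0..1} y"
  by (auto simp: smoothstep'_def indicator_def max_def)

lemma smoothstep'_ge: "1/4 \<le> y \<Longrightarrow> y \<le> 1/2 \<Longrightarrow> 1 \<le> smoothstep' y"
  by (auto simp: smoothstep'_def max_def)

lemma smoothstep_range: "0 \<le> smoothstep y" "smoothstep y \<le> 1"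
proof -
  have mono: "smoothstep x \<le> smoothstep y" if "x \<le> y" for x y
    using that DERIV_smoothstep smoothstep'_bounds(1) by (blast intro: DERIV_nonneg_imp_nondecreasing)
  show "0 \<le> smoothstep y" using mono[of "min y 0" y] smoothstep_left[of "min y 0"] by simp
  show "smoothstep y \<le> 1" using mono[of y "max y 1"] smoothstep_right[of "max y 1"] by simp
qed

text \<open>A bump that lives on \<open>x < 0\<close>, \<open>- 2 < t < 1\<close>.  Its left edge, of width one, moves to the right with speed
  \<open>C\<close> and reaches \<open>x = - 1\<close> at \<open>t = 1\<close>, so that its derivatives absorb an entropy flux bounded by \<open>C\<close>
  times the entropy.  Its right edge fills the strip of width \<open>\<epsilon>\<close> next to the boundary \<open>x = 0\<close>, where it
  measures the flux through the boundary.  The last factor only cuts off negative times.\<close>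

definition cone_cutoff :: "real \<Rightarrow> real \<Rightarrow> real \<times> real \<Rightarrow> real" where
  "cone_cutoff C \<epsilon> p = smoothstep (fst p + 2 + C - C * snd p) * smoothstep (- fst p / \<epsilon>) *
     smoothstep (1 - snd p) * smoothstep (snd p + 2)"

definition cone_cutoff_x :: "real \<Rightarrow> real \<Rightarrow> real \<times> real \<Rightarrow> real" where
  "cone_cutoff_x C \<epsilon> p =
     (smoothstep' (fst p + 2 + C - C * snd p) * smoothstep (- fst p / \<epsilon>)
      - smoothstep (fst p + 2 + C - C * snd p) * smoothstep' (- fst p / \<epsilon>) / \<epsilon>) *
     smoothstep (1 - snd p) * smoothstep (snd p + 2)"

definition cone_cutoff_t :: "real \<Rightarrow> real \<Rightarrow> real \<times> real \<Rightarrow> real" where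
  "cone_cutoff_t C \<epsilon> p =
     - C * smoothstep' (fst p + 2 + C - C * snd p) * smoothstep (- fst p / \<epsilon>) *
       smoothstep (1 - snd p) * smoothstep (snd p + 2)
     + smoothstep (fst p + 2 + C - C * snd p) * smoothstep (- fst p / \<epsilon>) *
       (smoothstep (1 - snd p) * smoothstep' (snd p + 2) - smoothstep' (1 - snd p) * smoothstep (snd p + 2))"

lemma has_derivative_smoothstep:
  assumes "(g has_derivative g') (at p)"
  shows "((\<lambda>p. smoothstep (g p)) has_derivative (\<lambda>h. smoothstep' (g p) * g' h)) (at p)"
proof -
  have "(smoothstep has_derivative (\<lambda>h. smoothstep' (g p) * h)) (at (g p))"
    using DERIV_smoothstep[of "g p"] by (simp add: has_field_derivative_def)
  from has_derivative_compose[OF assms this] show ?thesis .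
qed

lemma test_function_cone_cutoff:
  assumes "0 \<le> C" "0 < \<epsilon>"
  shows "test_function (cone_cutoff C \<epsilon>) (cone_cutoff_x C \<epsilon>) (cone_cutoff_t C \<epsilon>)"
  unfolding test_function_def
proof (intro conjI allI)
  show "0 \<le> cone_cutoff C \<epsilon> p" for p
    unfolding cone_cutoff_def by (intro mult_nonneg_nonneg smoothstep_range)
  show "continuous_on UNIV (cone_cutoff_x C \<epsilon>)" "continuous_on UNIV (cone_cutoff_t C \<epsilon>)"
    unfolding cone_cutoff_x_def[abs_def] cone_cutoff_t_def[abs_def]
    using assms(2) by (intro continuous_intros continuous_smoothstep continuous_smoothstep'; simp)+
  show "(cone_cutoff C \<epsilon> has_derivative (\<lambda>h. cone_cutoff_x C \<epsilon> p * fst h + cone_cutoff_t C \<epsilon> p * snd h)) (at p)" for p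
  proof -
    have "((\<lambda>p. smoothstep (fst p + 2 + C - C * snd p)) has_derivative
        (\<lambda>h. smoothstep' (fst p + 2 + C - C * snd p) * (fst h - C * snd h))) (at p)"
      by (rule has_derivative_smoothstep) (auto intro!: derivative_eq_intros)
    moreover have "((\<lambda>p. smoothstep (- fst p / \<epsilon>)) has_derivative
        (\<lambda>h. smoothstep' (- fst p / \<epsilon>) * (- fst h / \<epsilon>))) (at p)"
      using assms(2) by (intro has_derivative_smoothstep) (auto intro!: derivative_eq_intros)
    moreover have "((\<lambda>p. smoothstep (1 - snd p)) has_derivative
        (\<lambda>h. smoothstep' (1 - snd p) * (- snd h))) (at p)"
      by (rule has_derivative_smoothstep) (auto intro!: derivative_eq_intros)
    moreover have "((\<lambda>p. smoothstep (snd p + 2)) has_derivative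
        (\<lambda>h. smoothstep' (snd p + 2) * snd h)) (at p)"
      by (rule has_derivative_smoothstep) (auto intro!: derivative_eq_intros)
    ultimately show ?thesis
      unfolding cone_cutoff_def[abs_def]
      by (rule has_derivative_eq_rhs[OF has_derivative_mult[OF has_derivative_mult[OF has_derivative_mult]]])
        (simp add: cone_cutoff_x_def cone_cutoff_t_def algebra_simps fun_eq_iff)
  qed
  define R where "R = 4 + 3 * C"
  have "{p. cone_cutoff C \<epsilon> p \<noteq> 0} \<subseteq> cbox (-R, -R) (R, R)"
  proof
    fix p assume "p \<in> {p. cone_cutoff C \<epsilon> p \<noteq> 0}"
    then have nz: "cone_cutoff C \<epsilon> p \<noteq> 0" by simp
    have "snd p < 1" "- 2 < snd p" "0 < - fst p / \<epsilon>" "0 < fst p + 2 + C - C * snd p"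
      using nz smoothstep_left(1)[of "1 - snd p"] smoothstep_left(1)[of "snd p + 2"]
        smoothstep_left(1)[of "- fst p / \<epsilon>"] smoothstep_left(1)[of "fst p + 2 + C - C * snd p"]
      by (fastforce simp: cone_cutoff_def)+
    moreover from this have "C * (- 2) \<le> C * snd p" using assms(1) by (intro mult_left_mono) auto
    ultimately have "\<bar>fst p\<bar> \<le> R" "\<bar>snd p\<bar> \<le> R"
      using assms by (auto simp: R_def divide_less_0_iff abs_le_iff)
    then show "p \<in> cbox (-R, -R) (R, R)" by (cases p) (auto simp: cbox_Pair_eq)
  qed
  then show "compact (closure {p. cone_cutoff C \<epsilon> p \<noteq> 0})"
    using bounded_subset[OF bounded_cbox] by (simp add: compact_closure)
qed

lemma test_function_divergence:
  assumes tf: "test_function \<phi> \<phi>x \<phi>t"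
  shows "integrable lborel (\<lambda>p. indicator (UNIV \<times> {0<..}) p * \<phi>x p)"
    "integrable lborel (\<lambda>p. indicator (UNIV \<times> {0<..}) p * \<phi>t p)"
    "integrable lborel (\<lambda>x. \<phi> (x, 0))"
    "(LINT p|lborel. indicator (UNIV \<times> {0<..}) p * \<phi>x p) = 0"
    "(LINT p|lborel. indicator (UNIV \<times> {0<..}) p * \<phi>t p) = - (LINT x|lborel. \<phi> (x, 0))"
proof -
  obtain R K where RK: "R > 0" "K > 0" "\<And>p. \<bar>\<phi> p\<bar> \<le> K" "\<And>p. \<bar>\<phi>x p\<bar> \<le> K" "\<And>p. \<bar>\<phi>t p\<bar> \<le> K"
    "\<And>x t. R < \<bar>x\<bar> \<or> R < \<bar>t\<bar> \<Longrightarrow> \<phi> (x, t) = 0 \<and> \<phi>x (x, t) = 0 \<and> \<phi>t (x, t) = 0"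
    using test_functionE[OF tf] by metis
  note [measurable] = test_function_measurable[OF tf]
  have [measurable]: "UNIV \<times> {0::real<..} \<in> sets (borel :: (real \<times> real) measure)"
    by (auto simp: borel_Times)
  have int: "integrable lborel (\<lambda>p. indicator (UNIV \<times> {0<..}) p * g p)"
    if "g \<in> borel_measurable borel" "\<And>p. \<bar>g p\<bar> \<le> K" "\<And>x t. R < \<bar>x\<bar> \<or> R < \<bar>t\<bar> \<Longrightarrow> g (x, t) = 0"
    for g :: "real \<times> real \<Rightarrow> real"
  proof (rule integrable_bounded_support[where S = "cbox (-R, -R) (R, R)" and K = K])
    show "(\<lambda>p. indicator (UNIV \<times> {0<..}) p * g p) \<in> borel_measurable borel" using that(1) by measurable
    show "\<bar>indicator (UNIV \<times> {0<..}) p * g p\<bar> \<le> K" for p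
      using that(2)[of p] RK(2) by (simp add: indicator_def)
    show "indicator (UNIV \<times> {0<..}) p * g p = 0" if "p \<notin> cbox (-R, -R) (R, R)" for p
    proof -
      have "R < \<bar>fst p\<bar> \<or> R < \<bar>snd p\<bar>" using that by (cases p) (auto simp: cbox_Pair_eq)
      then show ?thesis using \<open>\<And>x t. R < \<bar>x\<bar> \<or> R < \<bar>t\<bar> \<Longrightarrow> g (x, t) = 0\<close>[of "fst p" "snd p"] by simp
    qed
  qed simp
  show ix: "integrable lborel (\<lambda>p. indicator (UNIV \<times> {0<..}) p * \<phi>x p)"
    and it: "integrable lborel (\<lambda>p. indicator (UNIV \<times> {0<..}) p * \<phi>t p)"
    using RK by (auto intro!: int)
  have horizontal: "continuous_on S (\<lambda>x. (x, t))" and vertical: "continuous_on S (\<lambda>t. (x, t))"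
    for x t :: real and S by (intro continuous_intros)+
  note cont_x = test_function_continuous[OF tf, THEN continuous_on_compose2, OF horizontal subset_UNIV]
  note cont_t = test_function_continuous[OF tf, THEN continuous_on_compose2, OF vertical subset_UNIV]
  show "integrable lborel (\<lambda>x. \<phi> (x, 0))"
  proof (rule integrable_bounded_support[where S = "{-R..R}" and K = K])
    show "\<phi> (x, 0) = 0" if "x \<notin> {-R..R}" for x
    proof -
      have "R < \<bar>x\<bar>" using that by auto
      then show ?thesis using RK(6)[of x 0] by simp
    qed
  qed (use RK(3) cont_x in \<open>auto intro: borel_measurable_continuous_onI\<close>)
  have "(LINT x|lborel. \<phi>x (x, t)) = 0" for t
  proof (rule LINT_line_derivative[where R = R])
    show "((\<lambda>x. \<phi> (x, t)) has_real_derivative \<phi>x (x, t)) (at x)" for x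
      using test_function_curve[OF tf DERIV_ident DERIV_const, of t x] by simp
  qed (use RK(6) cont_x in auto)
  then have "(LINT x|lborel. indicator (UNIV \<times> {0<..}) (x, t) * \<phi>x (x, t)) = 0" for t
    by (cases "0 < t") auto
  then show "(LINT p|lborel. indicator (UNIV \<times> {0<..}) p * \<phi>x p) = 0"
    unfolding Fubini_plane(2)[OF ix] by simp
  have "(LINT t|lborel. indicator {0<..} t * \<phi>t (x, t)) = - \<phi> (x, 0)" for x
  proof (rule LINT_halfline_derivative[where R = R])
    show "((\<lambda>t. \<phi> (x, t)) has_real_derivative \<phi>t (x, t)) (at t)" for t
      using test_function_curve[OF tf DERIV_const DERIV_ident, of x t] by simp
    show "\<phi> (x, t) = 0 \<and> \<phi>t (x, t) = 0" if "R < t" for t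
    proof -
      have "R < \<bar>t\<bar>" using that by linarith
      then show ?thesis using RK(6)[of x t] by simp
    qed
  qed (use cont_t in auto)
  then have "(LINT t|lborel. indicator (UNIV \<times> {0<..}) (x, t) * \<phi>t (x, t)) = - \<phi> (x, 0)" for x
    by (simp add: indicator_def)
  then show "(LINT p|lborel. indicator (UNIV \<times> {0<..}) p * \<phi>t p) = - (LINT x|lborel. \<phi> (x, 0))"
    unfolding Fubini_plane(3)[OF it] by simp
qed


section \<open>The flux at the boundary\<close>

text \<open>The one-sided entropy \<open>(u - k)\<^sup>+\<close>.  Because the data vanish for it on \<open>x < 0\<close> when \<open>a \<le> k\<close>, the initial
  term is absent for test functions that vanish on \<open>x \<ge> 0\<close> initially.\<close>

lemma upper_entropy_inequality:
  assumes sol: "entropy_solution f {lo..hi} (riemann_data a b) u" and f: "continuous_on UNIV f"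
    and order: "lo \<le> a" "a \<le> k" "k \<le> hi"
    and tf: "test_function \<phi> \<phi>x \<phi>t" and left: "\<And>x. 0 \<le> x \<Longrightarrow> \<phi> (x, 0) = 0"
  defines "J \<equiv> \<lambda>p. indicator (UNIV \<times> {0<..}) p *
      (max 0 (u p - k) * \<phi>t p + (if k < u p then f (u p) - f k else 0) * \<phi>x p)"
  shows "integrable lborel J" "0 \<le> (LINT p|lborel. J p)"
proof -
  define E where "E k p = indicator (UNIV \<times> {0<..}) p *
      (\<bar>u p - k\<bar> * \<phi>t p + sgn (u p - k) * (f (u p) - f k) * \<phi>x p)" for k p
  have [measurable]: "f \<in> borel_measurable borel" using f by (rule borel_measurable_continuous_onI)
  have um: "set_borel_measurable borel (UNIV \<times> {0<..}) u" and
    uI: "\<And>x t. 0 < t \<Longrightarrow> u (x, t) \<in> {lo..hi}"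
    using sol by (auto simp: entropy_solution_def)
  obtain R K where RK: "R > 0" "K > 0" "\<And>p. \<bar>\<phi> p\<bar> \<le> K" "\<And>p. \<bar>\<phi>x p\<bar> \<le> K" "\<And>p. \<bar>\<phi>t p\<bar> \<le> K"
    "\<And>x t. R < \<bar>x\<bar> \<or> R < \<bar>t\<bar> \<Longrightarrow> \<phi> (x, t) = 0 \<and> \<phi>x (x, t) = 0 \<and> \<phi>t (x, t) = 0"
    using test_functionE[OF tf] by metis
  have "bounded (f ` {lo..hi})"
    using f by (meson compact_Icc compact_continuous_image compact_imp_bounded continuous_on_subset subset_UNIV)
  then obtain B where B: "B > 0" "\<And>v. v \<in> {lo..hi} \<Longrightarrow> \<bar>f v\<bar> \<le> B" by (auto simp: bounded_pos)
  have iE: "integrable lborel (E k)" if k: "k \<in> {lo..hi}" for k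
  proof (rule integrable_bounded_support[where S = "cbox (-R, -R) (R, R)" and K = "(hi - lo) * K + 2 * B * K"])
    show "E k \<in> borel_measurable borel"
      unfolding E_def[abs_def] using test_function_measurable[OF tf]
      by (intro entropy_integrand_measurable um) auto
    show "E k p = 0" if "p \<notin> cbox (-R, -R) (R, R)" for p
    proof -
      have "R < \<bar>fst p\<bar> \<or> R < \<bar>snd p\<bar>" using that by (cases p) (auto simp: cbox_Pair_eq)
      then show ?thesis using RK(6)[of "fst p" "snd p"] by (simp add: E_def)
    qed
    show "\<bar>E k p\<bar> \<le> (hi - lo) * K + 2 * B * K" for p
    proof (cases "0 < snd p")
      case True
      then have u: "u p \<in> {lo..hi}" using uI[of "snd p" "fst p"] by simp
      have 1: "\<bar>\<bar>u p - k\<bar> * \<phi>t p\<bar> \<le> (hi - lo) * K"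
        unfolding abs_mult using u k RK(5)[of p] by (intro mult_mono) auto
      have "\<bar>sgn (u p - k) * (f (u p) - f k)\<bar> \<le> \<bar>f (u p) - f k\<bar>" by (simp add: abs_mult sgn_if)
      then have "\<bar>sgn (u p - k) * (f (u p) - f k)\<bar> \<le> 2 * B" using B(2)[OF u] B(2)[OF k] by linarith
      then have 2: "\<bar>sgn (u p - k) * (f (u p) - f k) * \<phi>x p\<bar> \<le> 2 * B * K"
        unfolding abs_mult[of _ "\<phi>x p"] using RK(4)[of p] B(1) by (intro mult_mono) auto
      show ?thesis using True 1 2 unfolding E_def by (auto simp: indicator_def mem_Times_iff)
    next
      case False
      have "0 \<le> (hi - lo) * K + 2 * B * K" using k RK(2) B(1) by auto
      with False show ?thesis by (simp add: E_def indicator_def mem_Times_iff)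
    qed
  qed simp
  have kI: "k \<in> {lo..hi}" "lo \<in> {lo..hi}" using order by auto
  note div = test_function_divergence[OF tf]
  \<comment> \<open>\<open>\<bar>u - k\<bar> + (u - lo) = 2 (u - k)\<^sup>+ + (k - lo)\<close>, and likewise for the fluxes.\<close>
  have split: "J p = (E k p + E lo p - ((k - lo) * (indicator (UNIV \<times> {0<..}) p * \<phi>t p)
      + (f k - f lo) * (indicator (UNIV \<times> {0<..}) p * \<phi>x p))) / 2" for p
  proof (cases "0 < snd p")
    case True
    then have "lo \<le> u p" using uI[of "snd p" "fst p"] by simp
    then have lo: "sgn (u p - lo) * (f (u p) - f lo) = f (u p) - f lo" "\<bar>u p - lo\<bar> = u p - lo"
      by (auto simp: sgn_if)
    have ind: "indicator (UNIV \<times> {0<..}) p = (1::real)" using True by (simp add: indicator_def mem_Times_iff)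
    show ?thesis
      unfolding J_def E_def lo ind by (auto simp: sgn_if max_def field_simps)
  qed (simp add: J_def E_def indicator_def mem_Times_iff)
  show "integrable lborel J"
    unfolding split using iE[OF kI(1)] iE[OF kI(2)] div(1,2) by simp
  have ent: "0 \<le> (LINT p|lborel. E k p) + (LINT x|lborel. \<bar>riemann_data a b x - k\<bar> * \<phi> (x, 0))"
    if "k \<in> {lo..hi}" for k
    using sol tf that unfolding entropy_solution_def set_lebesgue_integral_def E_def by force
  have data: "\<bar>riemann_data a b x - k\<bar> * \<phi> (x, 0) = (k - a) * \<phi> (x, 0)"
    "\<bar>riemann_data a b x - lo\<bar> * \<phi> (x, 0) = (a - lo) * \<phi> (x, 0)" for x
    using order left[of x] by (auto simp: riemann_data_def not_less)
  have "2 * (LINT p|lborel. J p) = (LINT p|lborel. E k p) + (LINT p|lborel. E lo p) + (k - lo) * (LINT x|lborel. \<phi> (x, 0))"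
    unfolding split using iE[OF kI(1)] iE[OF kI(2)] div by simp
  also have "\<dots> \<ge> 0"
    using ent[OF kI(1)] ent[OF kI(2)] unfolding data integral_mult_right_zero by (simp add: algebra_simps)
  finally show "0 \<le> (LINT p|lborel. J p)" by simp
qed

text \<open>The entropy integrand for the cone cutoff will be dominated by multiples of indicators of rectangles and of
  the parallelogram swept by the moving edge.\<close>

lemma LINT_indicator_rectangle:
  fixes a b c d :: real
  assumes "a \<le> b" "c \<le> d"
  shows "integrable lborel (\<lambda>p. indicator {a..b} (fst p) * indicator {c..d} (snd p) :: real)"
    and "(LINT p|lborel. indicator {a..b} (fst p) * indicator {c..d} (snd p)) = (b - a) * (d - c)"
proof -
  have eq: "(\<lambda>p. indicator {a..b} (fst p) * indicator {c..d} (snd p) :: real) = indicator (cbox (a, c) (b, d))"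
    by (auto simp: indicator_def cbox_Pair_eq fun_eq_iff)
  show "integrable lborel (\<lambda>p. indicator {a..b} (fst p) * indicator {c..d} (snd p) :: real)"
    unfolding eq by (intro integrable_real_indicator) (auto simp: emeasure_lborel_cbox_eq)
  show "(LINT p|lborel. indicator {a..b} (fst p) * indicator {c..d} (snd p)) = (b - a) * (d - c)"
    unfolding eq using assms by (simp add: content_Pair)
qed

lemma LINT_indicator_parallelogram:
  fixes c C :: real
  shows "integrable lborel (\<lambda>p. indicator {0..1} (fst p + c - C * snd p) * indicator {0..1} (snd p) :: real)"
    and "(LINT p|lborel. indicator {0..1} (fst p + c - C * snd p) * indicator {0..1} (snd p)) = (1 :: real)"
proof -
  note [measurable] = borel_measurable_coordinates
  define r where "r = \<bar>c\<bar> + \<bar>C\<bar> + 1"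
  show i: "integrable lborel (\<lambda>p. indicator {0..1} (fst p + c - C * snd p) * indicator {0..1} (snd p) :: real)"
  proof (rule integrable_bounded_support[where S = "cbox (-r, -r) (r, r)" and K = 1])
    show "(\<lambda>p. indicator {0..1} (fst p + c - C * snd p) * indicator {0..1} (snd p) :: real) \<in> borel_measurable borel"
      by measurable
    show "indicator {0..1} (fst p + c - C * snd p) * indicator {0..1} (snd p) = (0 :: real)"
      if "p \<notin> cbox (-r, -r) (r, r)" for p
    proof (rule ccontr)
      assume "\<not> ?thesis"
      then have t: "0 \<le> snd p" "snd p \<le> 1" and x: "0 \<le> fst p + c - C * snd p" "fst p + c - C * snd p \<le> 1"
        by (auto simp: indicator_def split: if_splits)
      have "\<bar>C * snd p\<bar> \<le> \<bar>C\<bar> * 1" unfolding abs_mult using t by (intro mult_left_mono) auto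
      then have "\<bar>fst p\<bar> \<le> r" "\<bar>snd p\<bar> \<le> r" using x t unfolding r_def by linarith+
      then show False using that by (cases p) (auto simp: cbox_Pair_eq)
    qed
  qed (auto simp: indicator_def)
  have slice: "(LINT x|lborel. indicator {0..1} (x + c - C * t) * indicator {0..1} t) = (indicator {0..1} t :: real)" for t
  proof -
    have eq: "(\<lambda>x. indicator {0..1} (x + c - C * t) :: real) = indicator {C * t - c..C * t - c + 1}"
      by (auto simp: indicator_def fun_eq_iff)
    have "(LINT x|lborel. indicator {0..1} (x + c - C * t)) = (1 :: real)" unfolding eq by simp
    then show ?thesis by simp
  qed
  show "(LINT p|lborel. indicator {0..1} (fst p + c - C * snd p) * indicator {0..1} (snd p)) = (1 :: real)"
    unfolding Fubini_plane(2)[OF i] fst_conv snd_conv slice by simp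
qed

text \<open>A substitute for a Lipschitz bound: up to a small additive error, the entropy flux is controlled by the
  entropy.  It provides a finite speed \<open>C\<close> for the cone of dependence even where the flux has infinite
  slope.\<close>

lemma affine_modulus_at:
  fixes f :: "real \<Rightarrow> real"
  assumes f: "continuous_on UNIV f" and "\<delta> > 0" "M > 0" "\<And>v. v \<in> I \<Longrightarrow> f v - f k \<le> M"
  obtains C where "C \<ge> 0" "\<And>v. v \<in> I \<Longrightarrow> k < v \<Longrightarrow> f v - f k \<le> \<delta> + C * (v - k)"
proof -
  obtain \<rho> where \<rho>: "\<rho> > 0" "\<And>v. \<bar>v - k\<bar> < \<rho> \<Longrightarrow> \<bar>f v - f k\<bar> < \<delta>"
    using f \<open>\<delta> > 0\<close> unfolding continuous_on_iff dist_real_def by (metis UNIV_I)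
  show ?thesis
  proof (rule that[of "M / \<rho>"])
    show "0 \<le> M / \<rho>" using assms \<rho>(1) by simp
    show "f v - f k \<le> \<delta> + M / \<rho> * (v - k)" if v: "v \<in> I" "k < v" for v
    proof (cases "v - k < \<rho>")
      case True
      then have "f v - f k < \<delta>" using \<rho>(2)[of v] v by auto
      moreover have "0 \<le> M / \<rho> * (v - k)" using assms \<rho>(1) v by simp
      ultimately show ?thesis by linarith
    next
      case False
      then have "M * 1 \<le> M * ((v - k) / \<rho>)" using assms(3) \<rho>(1) by (intro mult_left_mono) auto
      then show ?thesis using assms(4)[OF v(1)] \<open>\<delta> > 0\<close> by simp
    qed
  qed
qed

text \<open>The entropy \<open>(u - k)\<^sup>+\<close> starts from zero on \<open>x < 0\<close>.  If \<open>f b \<ge> f k\<close>, its flux through \<open>x = 0\<close> points out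
  of this half-line up to small errors, and almost none enters through the moving left edge of the cone.  Yet a
  definite amount of entropy is present near the boundary, where \<open>u\<close> is close to \<open>b > k\<close>.  This contradicts
  the entropy inequality.  The presence of entropy near the boundary is what makes the conclusion strict and thus
  excludes a standing shock.\<close>

lemma left_trace_flux_less:
  assumes f: "continuous_on UNIV f"
    and sol: "entropy_solution f {lo..hi} (riemann_data a b) (\<lambda>(x, t). w (x / t))"
    and trace: "(w \<longlongrightarrow> b) (at_left 0)"
    and order: "lo \<le> a" "a \<le> k" "k < b" "b \<le> hi"
  shows "f b < f k"
proof (rule ccontr)
  assume "\<not> f b < f k"
  then have fbk: "f k \<le> f b" by simp
  define u where "u p = w (fst p / snd p)" for p :: "real \<times> real"
  have sol': "entropy_solution f {lo..hi} (riemann_data a b) u"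
    using sol by (simp add: u_def[abs_def] case_prod_unfold)
  have uI: "u p \<in> {lo..hi}" if "0 < snd p" for p
    using sol' that unfolding entropy_solution_def by (cases p) auto
  have "bounded (f ` {lo..hi})"
    using f by (meson compact_Icc compact_continuous_image compact_imp_bounded continuous_on_subset subset_UNIV)
  then obtain B where B: "B > 0" "\<And>v. v \<in> {lo..hi} \<Longrightarrow> \<bar>f v\<bar> \<le> B" by (auto simp: bounded_pos)
  define M where "M = 2 * B"
  have M: "M > 0" "\<And>v. v \<in> {lo..hi} \<Longrightarrow> \<bar>f v - f k\<bar> \<le> M"
  proof -
    show "M > 0" using B(1) by (simp add: M_def)
    show "\<bar>f v - f k\<bar> \<le> M" if "v \<in> {lo..hi}" for v
      using B(2)[OF that] B(2)[of k] order unfolding M_def by auto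
  qed
  define \<beta> where "\<beta> = (b - k) / 2"
  have \<beta>: "\<beta> > 0" using order by (simp add: \<beta>_def)
  have "eventually (\<lambda>\<xi>. k + \<beta> < w \<xi>) (at_left 0)"
    using order by (intro order_tendstoD(1)[OF trace]) (simp add: \<beta>_def field_simps)
  then obtain r0' where r0': "r0' < 0" "\<And>\<xi>. r0' < \<xi> \<Longrightarrow> \<xi> < 0 \<Longrightarrow> k + \<beta> < w \<xi>"
    unfolding eventually_at_left_field by blast
  define r0 where "r0 = min 1 (- r0')"
  have r0: "0 < r0" "r0 \<le> 1" "\<And>\<xi>. - r0 < \<xi> \<Longrightarrow> \<xi> < 0 \<Longrightarrow> k + \<beta> < w \<xi>"
    using r0' by (auto simp: r0_def min_def split: if_splits)
  \<comment> \<open>The entropy near the boundary will contribute at least \<open>\<beta> r0 / 32\<close>; \<open>\<delta>\<close> and \<open>\<epsilon>\<close> are chosen so that the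
    errors \<open>4 \<delta>\<close> and \<open>2 M \<epsilon> / r1\<close> add up to less.\<close>
  define \<delta> where "\<delta> = \<beta> * r0 / 256"
  have \<delta>: "\<delta> > 0" using \<beta> r0 by (simp add: \<delta>_def)
  obtain C where C: "C \<ge> 0" "\<And>v. v \<in> {lo..hi} \<Longrightarrow> k < v \<Longrightarrow> f v - f k \<le> \<delta> + C * (v - k)"
    using affine_modulus_at[OF f \<delta> M(1), of "{lo..hi}" k] M(2) by (metis abs_le_D1)
  have "((\<lambda>\<xi>. f (w \<xi>)) \<longlongrightarrow> f b) (at_left 0)"
    using f trace by (intro isCont_tendsto_compose[of b f]) (auto simp: continuous_on_eq_continuous_at)
  then have "eventually (\<lambda>\<xi>. f k - \<delta> < f (w \<xi>)) (at_left 0)"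
    using fbk \<delta> by (intro order_tendstoD(1)) auto
  then obtain r1' where r1': "r1' < 0" "\<And>\<xi>. r1' < \<xi> \<Longrightarrow> \<xi> < 0 \<Longrightarrow> f k - \<delta> < f (w \<xi>)"
    unfolding eventually_at_left_field by blast
  define r1 where "r1 = min r0 (- r1')"
  have r1: "0 < r1" "\<And>\<xi>. - r1 < \<xi> \<Longrightarrow> \<xi> < 0 \<Longrightarrow> f k - \<delta> < f (w \<xi>)"
    using r1' r0(1) by (auto simp: r1_def min_def split: if_splits)
  define \<epsilon> where "\<epsilon> = min (r0 / 8) (r1 * \<beta> * r0 / (512 * M))"
  have \<epsilon>: "0 < \<epsilon>" "\<epsilon> \<le> r0 / 8" "M * (\<epsilon> / r1) \<le> \<beta> * r0 / 512"
  proof -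
    show "0 < \<epsilon>" "\<epsilon> \<le> r0 / 8" using r0 r1(1) \<beta> M(1) by (auto simp: \<epsilon>_def)
    have "\<epsilon> \<le> r1 * \<beta> * r0 / (512 * M)" by (simp add: \<epsilon>_def)
    then show "M * (\<epsilon> / r1) \<le> \<beta> * r0 / 512" using r1(1) M(1) by (simp add: field_simps)
  qed
  define J where "J p = indicator (UNIV \<times> {0<..}) p *
      (max 0 (u p - k) * cone_cutoff_t C \<epsilon> p + (if k < u p then f (u p) - f k else 0) * cone_cutoff_x C \<epsilon> p)" for p
  have J: "integrable lborel J" "0 \<le> (LINT p|lborel. J p)"
    unfolding J_def[abs_def]
    using order smoothstep_left(1) \<epsilon>(1)
    by (intro upper_entropy_inequality[OF sol' f _ _ _ test_function_cone_cutoff[OF C(1) \<epsilon>(1)]];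
        simp add: cone_cutoff_def)+
  \<comment> \<open>\<open>loss\<close>: here \<open>u > k + \<beta>\<close> and the cutoff decreases in time at least at unit rate.  \<open>edge\<close>: the moving
    left edge.  \<open>strip\<close>: the flux through the boundary.  \<open>corner\<close>: the early part of the strip, which is not
    within \<open>- r1 t < x\<close>, so that the flux there is only bounded by \<open>M\<close>.\<close>
  define loss where "loss p = indicator {- r0/4..- r0/8} (fst p) * (indicator {1/2..3/4} (snd p) :: real)" for p :: "real \<times> real"
  define edge where "edge p = indicator {0..1} (fst p + (2 + C) - C * snd p) * (indicator {0..1} (snd p) :: real)" for p :: "real \<times> real"
  define strip where "strip p = indicator {- \<epsilon>..0} (fst p) * (indicator {0..1} (snd p) :: real)" for p :: "real \<times> real"
  define corner where "corner p = indicator {- \<epsilon>..0} (fst p) * (indicator {0..\<epsilon> / r1} (snd p) :: real)" for p :: "real \<times> real"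
  define G where "G p = 2 * \<delta> * edge p + 2 * \<delta> / \<epsilon> * strip p + 2 * M / \<epsilon> * corner p - \<beta> * loss p" for p
  have iG: "integrable lborel loss" "integrable lborel edge" "integrable lborel strip" "integrable lborel corner"
    unfolding loss_def[abs_def] edge_def[abs_def] strip_def[abs_def] corner_def[abs_def]
    using r0 r1 \<epsilon>
    by (intro LINT_indicator_rectangle(1) LINT_indicator_parallelogram(1); simp)+
  have vG: "(LINT p|lborel. loss p) = r0 / 8 * (1 / 4)" "(LINT p|lborel. edge p) = 1"
    "(LINT p|lborel. strip p) = \<epsilon>" "(LINT p|lborel. corner p) = \<epsilon> * (\<epsilon> / r1)"
    unfolding loss_def edge_def strip_def corner_def LINT_indicator_parallelogram(2)
    using r0(1) r1(1) \<epsilon>(1) LINT_indicator_rectangle(2)[of "- r0/4" "- r0/8" "1/2" "3/4"]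
      LINT_indicator_rectangle(2)[of "- \<epsilon>" 0 0 1] LINT_indicator_rectangle(2)[of "- \<epsilon>" 0 0 "\<epsilon> / r1"]
    by (simp_all add: field_simps)
  have nonneg: "0 \<le> edge p" "0 \<le> strip p" "0 \<le> corner p" for p
    by (auto simp: edge_def strip_def corner_def)
  have pointwise: "J p \<le> G p" for p
  proof -
    obtain x t where p: "p = (x, t)" by (cases p)
    have loss0: "0 \<le> G p" if "loss p = 0"
      unfolding G_def using that nonneg[of p] \<delta> \<epsilon>(1) M(1) by simp
    consider "t \<le> 0" | "1 \<le> t" | "0 \<le> x" | "0 < t" "t < 1" "x < 0" by linarith
    then show ?thesis
    proof cases
      case 1
      then show ?thesis using loss0 by (auto simp: p J_def loss_def)
    next
      case 2
      then have "J p = 0" using smoothstep_left[of "1 - t"] by (simp add: p J_def cone_cutoff_t_def cone_cutoff_x_def)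
      with 2 show ?thesis using loss0 by (auto simp: p loss_def)
    next
      case 3
      then have "- x / \<epsilon> \<le> 0" using \<epsilon>(1) by simp
      then have "J p = 0" using smoothstep_left[of "- x / \<epsilon>"] by (simp add: p J_def cone_cutoff_t_def cone_cutoff_x_def)
      with 3 show ?thesis using loss0 r0(1) by (auto simp: p loss_def)
    next
      case 4
      define X where "X = x + 2 + C - C * t"
      define Y where "Y = - x / \<epsilon>"
      define v where "v = max 0 (u p - k)"
      define H where "H = (if k < u p then f (u p) - f k else 0)"
      have uI': "u p \<in> {lo..hi}" using uI[of p] 4 by (simp add: p)
      have cut: "smoothstep (t + 2) = 1" "smoothstep' (t + 2) = 0"
        using 4 smoothstep_right[of "t + 2"] by auto
      have Jp: "J p = (H - C * v) * (smoothstep' X * smoothstep Y * smoothstep (1 - t))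
          - v * (smoothstep X * smoothstep Y * smoothstep' (1 - t))
          + (- H) * (smoothstep X * smoothstep' Y * smoothstep (1 - t) / \<epsilon>)"
        using 4 cut by (simp add: J_def p cone_cutoff_t_def cone_cutoff_x_def X_def Y_def v_def[unfolded p]
            H_def[unfolded p] algebra_simps diff_divide_distrib)
      have vnn: "0 \<le> v" by (simp add: v_def)
      have prod01: "smoothstep y * smoothstep z \<le> 1" for y z
        using mult_mono[OF smoothstep_range(2)[of y] smoothstep_range(2)[of z]] smoothstep_range(1) by simp
      have "(H - C * v) * (smoothstep' X * smoothstep Y * smoothstep (1 - t)) \<le> 2 * \<delta> * edge p"
      proof -
        \<comment> \<open>The speed of the edge pays for the influx of entropy up to \<open>\<delta>\<close>.\<close>
        have "H - C * v \<le> \<delta>"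
          using C(2)[OF uI'] \<delta> by (auto simp: H_def v_def max_def)
        then have "(H - C * v) * (smoothstep' X * smoothstep Y * smoothstep (1 - t))
            \<le> \<delta> * (smoothstep' X * smoothstep Y * smoothstep (1 - t))"
          by (intro mult_right_mono mult_nonneg_nonneg smoothstep_range smoothstep'_bounds)
        also have "\<dots> = \<delta> * (smoothstep' X * (smoothstep Y * smoothstep (1 - t)))" by simp
        also have "\<dots> \<le> \<delta> * (2 * indicator {0..1} X * 1)"
          using \<delta> by (intro mult_left_mono mult_mono smoothstep'_bounds prod01 mult_nonneg_nonneg smoothstep_range) auto
        also have "\<dots> = 2 * \<delta> * edge p" using 4 by (simp add: edge_def p X_def algebra_simps)
        finally show ?thesis .
      qed
      moreover have "\<beta> * loss p \<le> v * (smoothstep X * smoothstep Y * smoothstep' (1 - t))"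
      proof (cases "loss p = 0")
        case True
        then show ?thesis
          using vnn by (simp add: smoothstep_range smoothstep'_bounds)
      next
        case False
        then have xt: "- r0/4 \<le> x" "x \<le> - r0/8" "1/2 \<le> t" "t \<le> 3/4"
          by (auto simp: loss_def p indicator_def split: if_splits)
        have "- r0 * t < x" using xt(1) r0(1) mult_left_mono[OF xt(3), of r0] by linarith
        then have "- r0 < x / t" "x / t < 0" using 4 by (auto simp: field_simps)
        then have "\<beta> \<le> v" using r0(3)[of "x / t"] by (simp add: v_def u_def p)
        moreover have "smoothstep X = 1"
        proof (rule smoothstep_right(1))
          have "C * t \<le> C * 1" using C(1) 4 by (intro mult_left_mono) auto
          then show "1 \<le> X" using xt r0(2) unfolding X_def by linarith
        qed
        moreover have "smoothstep Y = 1"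
          using xt \<epsilon> by (intro smoothstep_right(1)) (simp add: Y_def field_simps)
        moreover have "1 \<le> smoothstep' (1 - t)" using xt by (intro smoothstep'_ge) auto
        moreover have "loss p = 1" using False by (auto simp: loss_def indicator_def split: if_splits)
        ultimately show ?thesis using mult_mono[of \<beta> v 1 "smoothstep' (1 - t)"] vnn by simp
      qed
      moreover have "(- H) * (smoothstep X * smoothstep' Y * smoothstep (1 - t) / \<epsilon>)
          \<le> 2 * \<delta> / \<epsilon> * strip p + 2 * M / \<epsilon> * corner p"
      proof (cases "Y \<in> {0..1}")
        case False
        then have "smoothstep' Y = 0" using smoothstep_left(2)[of Y] smoothstep_right(2)[of Y] by auto
        then show ?thesis using nonneg[of p] \<delta> M(1) \<epsilon>(1) by simp
      next
        case True
        then have x: "- \<epsilon> \<le> x" using \<epsilon>(1) by (simp add: Y_def field_simps)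
        then have strip: "strip p = 1" using 4 by (simp add: strip_def p)
        have "- H \<le> \<delta> + M * corner p"
        proof (cases "t \<le> \<epsilon> / r1")
          case True
          then have "corner p = 1" using 4 x by (simp add: corner_def p)
          then show ?thesis using M(2)[OF uI'] M(1) \<delta> by (auto simp: H_def)
        next
          case False
          then have "\<epsilon> < r1 * t" using r1(1) by (simp add: field_simps)
          then have "- r1 < x / t" "x / t < 0" using 4 x by (auto simp: field_simps)
          then have "- H \<le> \<delta>" using r1(2)[of "x / t"] \<delta> by (simp add: H_def u_def p)
          then show ?thesis using nonneg(3)[of p] M(1) by (simp add: add_increasing2)
        qed
        then have "(- H) * (smoothstep X * smoothstep' Y * smoothstep (1 - t) / \<epsilon>)
            \<le> (\<delta> + M * corner p) * (smoothstep X * smoothstep' Y * smoothstep (1 - t) / \<epsilon>)"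
          using \<epsilon>(1) by (intro mult_right_mono divide_nonneg_pos mult_nonneg_nonneg smoothstep_range smoothstep'_bounds)
        also have "\<dots> \<le> (\<delta> + M * corner p) * (2 / \<epsilon>)"
        proof (intro mult_left_mono divide_right_mono)
          have "smoothstep X * smoothstep' Y * smoothstep (1 - t) = (smoothstep X * smoothstep (1 - t)) * smoothstep' Y" by simp
          also have "\<dots> \<le> 1 * 2"
            using smoothstep'_bounds(2)[of Y] True by (intro mult_mono prod01 smoothstep'_bounds) auto
          finally show "smoothstep X * smoothstep' Y * smoothstep (1 - t) \<le> 2" by simp
          show "0 \<le> \<delta> + M * corner p" using \<delta> M(1) nonneg(3)[of p] by simp
        qed (use \<epsilon>(1) in simp)
        also have "\<dots> = 2 * \<delta> / \<epsilon> * strip p + 2 * M / \<epsilon> * corner p"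
          unfolding strip by (simp add: algebra_simps add_divide_distrib)
        finally show ?thesis .
      qed
      ultimately show ?thesis unfolding Jp G_def by linarith
    qed
  qed
  have "(LINT p|lborel. J p) \<le> (LINT p|lborel. G p)"
    using pointwise iG J(1) unfolding G_def by (intro integral_mono) auto
  also have "(LINT p|lborel. G p) = 2 * \<delta> + 2 * \<delta> + 2 * (M * (\<epsilon> / r1)) - \<beta> * (r0 / 8 * (1 / 4))"
    unfolding G_def using iG \<epsilon>(1) by (simp add: vG)
  also have "\<dots> \<le> 4 * \<delta> + 2 * (\<beta> * r0 / 512) - \<beta> * r0 / 32"
    using \<epsilon>(3) by linarith
  also have "\<dots> < 0" using \<beta> r0(1) by (simp add: \<delta>_def)
  finally show False using J(2) by simp
qed


section \<open>Strict extrema characterise one-sided waves\<close>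

lemma left_wave_uminus:
  assumes "left_wave f I a b w"
  shows "left_wave (\<lambda>v. - f (- v)) (uminus ` I) (- a) (- b) (\<lambda>\<xi>. - w \<xi>)"
proof -
  have "entropy_solution (\<lambda>v. - f (- v)) (uminus ` I) (\<lambda>x. - riemann_data a b x)
      (\<lambda>p. - (case p of (x, t) \<Rightarrow> w (x / t)))"
    using assms by (intro entropy_solution_uminus) (simp add: left_wave_def)
  moreover have "(\<lambda>x. - riemann_data a b x) = riemann_data (- a) (- b)"
    by (auto simp: riemann_data_def)
  moreover have "(\<lambda>p. - (case p of (x, t) \<Rightarrow> w (x / t))) = (\<lambda>(x, t). - w (x / t))" by auto
  moreover have "(\<lambda>\<xi>. - w \<xi>) constant_on {0<..}"
    using assms by (auto simp: left_wave_def constant_on_def)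
  moreover have "((\<lambda>\<xi>. - w \<xi>) \<longlongrightarrow> - b) (at_left 0)"
    using assms by (auto simp: left_wave_def intro: tendsto_minus)
  ultimately show ?thesis by (simp add: left_wave_def)
qed

text \<open>For \<open>a \<le> b\<close> the second condition is void, for \<open>a > b\<close> the first; the two cases are exchanged by the
  symmetry \<open>v \<mapsto> - v\<close>.\<close>

lemma left_wave_iff_continuous:
  assumes f: "continuous_on UNIV f" and I: "a \<in> {lo..hi}" "b \<in> {lo..hi}"
  shows "(\<exists>w. left_wave f {lo..hi} a b w) \<longleftrightarrow> (\<forall>k\<in>{a..<b}. f b < f k) \<and> (\<forall>k\<in>{b<..a}. f k < f b)"
proof -
  have f': "continuous_on UNIV (\<lambda>v. - f (- v))"
    using f by (intro continuous_intros) (auto intro!: continuous_on_compose2[of UNIV f] continuous_intros)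
  have neg: "uminus ` {lo..hi} = {- hi..- lo}" for lo hi :: real by simp
  have "f b < f k" if "left_wave f {lo..hi} a b w" "k \<in> {a..<b}" for k w
    using that I unfolding left_wave_def by (intro left_trace_flux_less[OF f, of lo hi a b w k]) auto
  moreover have "f k < f b" if "left_wave f {lo..hi} a b w" "k \<in> {b<..a}" for k w
    using left_wave_uminus[OF that(1)] that(2) I unfolding left_wave_def neg
    using left_trace_flux_less[OF f', of "- hi" "- lo" "- a" "- b" "\<lambda>\<xi>. - w \<xi>" "- k"] by auto
  moreover have "\<exists>w. left_wave f {lo..hi} a b w"
    if strict: "(\<forall>k\<in>{a..<b}. f b < f k) \<and> (\<forall>k\<in>{b<..a}. f k < f b)"
  proof (cases "a \<le> b")
    case True
    then show ?thesis using strict I by (intro left_wave_exists f) auto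
  next
    case False
    have "\<exists>w. left_wave (\<lambda>v. - f (- v)) {- hi..- lo} (- a) (- b) w"
    proof (rule left_wave_exists[OF f'])
      show "- f (- (- b)) < - f (- k)" if "- a \<le> k" "k < - b" for k
        using bspec[OF conjunct2[OF strict], of "- k"] that by auto
    qed (use False I in auto)
    then obtain w where "left_wave (\<lambda>v. - f (- v)) {- hi..- lo} (- a) (- b) w" by blast
    from left_wave_uminus[OF this] show ?thesis by auto
  qed
  ultimately show ?thesis by blast
qed

lemma entropy_solution_cong_data:
  assumes "\<And>x. x \<noteq> 0 \<Longrightarrow> g x = h x"
  shows "entropy_solution f I g u \<longleftrightarrow> entropy_solution f I h u"
proof -
  have "(LINT x|lborel. \<bar>g x - k\<bar> * \<phi> (x, 0)) = (LINT x|lborel. \<bar>h x - k\<bar> * \<phi> (x, 0))"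
    for k and \<phi> :: "real \<times> real \<Rightarrow> real"
    using assms by (intro integral_discrete_difference[where X = "{0}"]) auto
  then show ?thesis by (simp add: entropy_solution_def)
qed

text \<open>Downstream admissibility in terms of densities.  As in \<open>left_wave\<close>, \<open>a\<close> is the state far away and \<open>b\<close> the
  one at the boundary, so that \<open>b\<close> is now the left state of the Riemann problem.\<close>

definition right_wave :: "(real \<Rightarrow> real) \<Rightarrow> real set \<Rightarrow> real \<Rightarrow> real \<Rightarrow> (real \<Rightarrow> real) \<Rightarrow> bool" where
  "right_wave f I a b w \<longleftrightarrow>
     entropy_solution f I (riemann_data b a) (\<lambda>(x, t). w (x / t)) \<and>
     w constant_on {..<0} \<and> (w \<longlongrightarrow> b) (at_right 0)"

lemma self_similar_reflect:
  assumes "entropy_solution f I (riemann_data a b) (\<lambda>(x, t). w (x / t))" "f \<in> borel_measurable borel"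
  shows "entropy_solution (\<lambda>v. - f v) I (riemann_data b a) (\<lambda>(x, t). w (- (x / t)))"
proof -
  have "entropy_solution (\<lambda>v. - f v) I (\<lambda>x. riemann_data a b (- x)) (\<lambda>(x, t). w (- (x / t)))"
    using entropy_solution_reflect[OF assms] by simp
  then show ?thesis
    by (subst entropy_solution_cong_data[where h = "\<lambda>x. riemann_data a b (- x)"]) (auto simp: riemann_data_def)
qed

lemma constant_on_reflect:
  fixes w :: "real \<Rightarrow> real"
  shows "w constant_on {..<0} \<Longrightarrow> (\<lambda>\<xi>. w (- \<xi>)) constant_on {0<..}"
    and "w constant_on {0<..} \<Longrightarrow> (\<lambda>\<xi>. w (- \<xi>)) constant_on {..<0}"
  by (auto simp: constant_on_def)

lemma right_wave_reflect:
  assumes "f \<in> borel_measurable borel"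
  shows "(\<exists>w. right_wave f I a b w) \<longleftrightarrow> (\<exists>w. left_wave (\<lambda>v. - f v) I a b w)"
proof
  assume "\<exists>w. right_wave f I a b w"
  then obtain w where w: "entropy_solution f I (riemann_data b a) (\<lambda>(x, t). w (x / t))"
    "w constant_on {..<0}" "(w \<longlongrightarrow> b) (at_right 0)" by (auto simp: right_wave_def)
  have "((\<lambda>\<xi>. w (- \<xi>)) \<longlongrightarrow> b) (at_left 0)" using w(3) by (simp add: filterlim_at_left_to_right)
  then have "left_wave (\<lambda>v. - f v) I a b (\<lambda>\<xi>. w (- \<xi>))"
    using self_similar_reflect[OF w(1) assms] constant_on_reflect(1)[OF w(2)] by (simp add: left_wave_def)
  then show "\<exists>w. left_wave (\<lambda>v. - f v) I a b w" by blast
next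
  assume "\<exists>w. left_wave (\<lambda>v. - f v) I a b w"
  then obtain w where w: "entropy_solution (\<lambda>v. - f v) I (riemann_data a b) (\<lambda>(x, t). w (x / t))"
    "w constant_on {0<..}" "(w \<longlongrightarrow> b) (at_left 0)" by (auto simp: left_wave_def)
  have "((\<lambda>\<xi>. w (- \<xi>)) \<longlongrightarrow> b) (at_right 0)" using w(3) by (simp add: filterlim_at_left_to_right)
  then have "right_wave f I a b (\<lambda>\<xi>. w (- \<xi>))"
    using self_similar_reflect[OF w(1)] assms constant_on_reflect(2)[OF w(2)] by (simp add: right_wave_def)
  then show "\<exists>w. right_wave f I a b w" by blast
qed

text \<open>Fluxes that are continuous on the whole line make the integrands measurable without restriction to the
  range of the solution.\<close>

lemma continuous_extension_Icc:
  fixes f :: "real \<Rightarrow> real"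
  assumes "continuous_on {lo..hi} f" "lo \<le> hi"
  obtains g where "continuous_on UNIV g" "\<And>v. v \<in> {lo..hi} \<Longrightarrow> g v = f v"
proof (rule that[of "\<lambda>v. f (max lo (min hi v))"])
  show "continuous_on UNIV (\<lambda>v. f (max lo (min hi v)))"
    using assms by (intro continuous_on_compose2[OF assms(1)] continuous_intros) auto
qed auto

proposition left_wave_iff:
  assumes "continuous_on {lo..hi} f" and I: "a \<in> {lo..hi}" "b \<in> {lo..hi}"
  shows "(\<exists>w. left_wave f {lo..hi} a b w) \<longleftrightarrow> (\<forall>k\<in>{a..<b}. f b < f k) \<and> (\<forall>k\<in>{b<..a}. f k < f b)"
proof -
  obtain g where g: "continuous_on UNIV g" "\<And>v. v \<in> {lo..hi} \<Longrightarrow> g v = f v"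
    using continuous_extension_Icc[OF assms(1)] I by auto
  have "left_wave f {lo..hi} a b w \<longleftrightarrow> left_wave g {lo..hi} a b w" for w
    using entropy_solution_cong_flux[of "{lo..hi}" g f] g(2) by (simp add: left_wave_def)
  moreover have "(\<forall>k\<in>{a..<b}. g b < g k) \<and> (\<forall>k\<in>{b<..a}. g k < g b)
      \<longleftrightarrow> (\<forall>k\<in>{a..<b}. f b < f k) \<and> (\<forall>k\<in>{b<..a}. f k < f b)"
    using g(2) I by auto
  ultimately show ?thesis using left_wave_iff_continuous[OF g(1) I] by simp
qed

proposition right_wave_iff:
  assumes "continuous_on {lo..hi} f" and I: "a \<in> {lo..hi}" "b \<in> {lo..hi}"
  shows "(\<exists>w. right_wave f {lo..hi} a b w) \<longleftrightarrow> (\<forall>k\<in>{a..<b}. f k < f b) \<and> (\<forall>k\<in>{b<..a}. f b < f k)"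
proof -
  obtain g where g: "continuous_on UNIV g" "\<And>v. v \<in> {lo..hi} \<Longrightarrow> g v = f v"
    using continuous_extension_Icc[OF assms(1)] I by auto
  have "right_wave f {lo..hi} a b w \<longleftrightarrow> right_wave g {lo..hi} a b w" for w
    using entropy_solution_cong_flux[of "{lo..hi}" g f] g(2) by (simp add: right_wave_def)
  then have "(\<exists>w. right_wave f {lo..hi} a b w) \<longleftrightarrow> (\<exists>w. left_wave (\<lambda>v. - g v) {lo..hi} a b w)"
    using right_wave_reflect[OF borel_measurable_continuous_onI[OF g(1)]] by simp
  also have "\<dots> \<longleftrightarrow> (\<forall>k\<in>{a..<b}. g k < g b) \<and> (\<forall>k\<in>{b<..a}. g b < g k)"
    using left_wave_iff_continuous[OF continuous_on_minus[OF g(1)] I] by simp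
  also have "\<dots> \<longleftrightarrow> (\<forall>k\<in>{a..<b}. f k < f b) \<and> (\<forall>k\<in>{b<..a}. f b < f k)"
    using g(2) I by auto
  finally show ?thesis .
qed

section \<open>Unimodal fluxes and traffic states\<close>

lemma fundamental_diagram_strict:
  assumes "fundamental_diagram L"
  shows "0 \<le> crit L" "crit L \<le> jam L"
    and "\<And>r s. 0 \<le> r \<Longrightarrow> r < s \<Longrightarrow> s \<le> crit L \<Longrightarrow> flux L r < flux L s"
    and "\<And>r s. crit L \<le> r \<Longrightarrow> r < s \<Longrightarrow> s \<le> jam L \<Longrightarrow> flux L s < flux L r"
  using assms unfolding fundamental_diagram_def monotone_on_def by auto

lemma demand_eq_capacity_iff:
  assumes "fundamental_diagram L" "r \<in> {0..jam L}"
  shows "link_demand L r = capacity L \<longleftrightarrow> crit L \<le> r"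
  using fundamental_diagram_strict(3)[OF assms(1), of r "crit L"] assms(2)
  by (cases "crit L \<le> r") (auto simp: link_demand_def capacity_def min_def)

lemma supply_eq_capacity_iff:
  assumes "fundamental_diagram L" "r \<in> {0..jam L}"
  shows "link_supply L r = capacity L \<longleftrightarrow> r \<le> crit L"
  using fundamental_diagram_strict(4)[OF assms(1), of "crit L" r] assms(2)
  by (cases "r \<le> crit L") (auto simp: link_supply_def capacity_def max_def)

text \<open>For a unimodal flux both sides say that the boundary density \<open>b\<close> is \<open>min a c\<close>, with \<open>c\<close> the critical
  density, or is congested (\<open>b \<ge> c\<close>) with a flux strictly below that of \<open>min a c\<close>, which is the demand of \<open>a\<close>.
  Any other \<open>b\<close> fails against \<open>k = min a c\<close> or \<open>k = a\<close>.\<close>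

lemma upstream_states_iff:
  assumes L: "fundamental_diagram L" and I: "a \<in> {0..jam L}" "b \<in> {0..jam L}"
  shows "(\<forall>k\<in>{a..<b}. flux L b < flux L k) \<and> (\<forall>k\<in>{b<..a}. flux L k < flux L b) \<longleftrightarrow>
    state_of L b = (link_demand L a, capacity L) \<or>
    (\<exists>S. state_of L b = (capacity L, S) \<and> S < link_demand L a)" (is "?K \<longleftrightarrow> ?states")
proof -
  let ?c = "crit L" and ?Q = "flux L"
  note inc = fundamental_diagram_strict(3)[OF L] and dec = fundamental_diagram_strict(4)[OF L]
  note c = fundamental_diagram_strict(1,2)[OF L]
  have "?Q b = ?Q m \<longleftrightarrow> b = m" if "b \<le> ?c" "0 \<le> m" "m \<le> ?c" for m
    using inc[of b m] inc[of m b] I that by (cases b m rule: linorder_cases) auto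
  from this[of "min a ?c"] have "?Q b = ?Q (min a ?c) \<longleftrightarrow> b = min a ?c" if "b \<le> ?c"
    using that I c by simp
  then have "?states \<longleftrightarrow> b = min a ?c \<or> ?c \<le> b \<and> ?Q b < ?Q (min a ?c)"
    using demand_eq_capacity_iff[OF L I(2)] supply_eq_capacity_iff[OF L I(2)]
    by (auto simp: state_of_def link_demand_def link_supply_def)
  also have "\<dots> \<longleftrightarrow> ?K"
  proof
    assume K: ?K
    consider "b < min a ?c" | "b = min a ?c" | "a < b" "b < ?c" | "min a ?c < b" "?c \<le> b" by linarith
    then show "b = min a ?c \<or> ?c \<le> b \<and> ?Q b < ?Q (min a ?c)"
    proof cases
      case 1
      then have "?Q (min a ?c) < ?Q b" using K by auto
      then show ?thesis using inc[of b "min a ?c"] 1 I by auto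
    next
      case 3
      then have "?Q b < ?Q a" using K by auto
      then show ?thesis using inc[of a b] 3 I by auto
    next
      case 4
      then show ?thesis using K dec[of ?c b] I by (cases "a \<le> ?c") auto
    qed simp
  next
    assume "b = min a ?c \<or> ?c \<le> b \<and> ?Q b < ?Q (min a ?c)"
    then show ?K
    proof
      assume "b = min a ?c"
      then show ?K using dec[of ?c] I by (auto simp: min_def)
    next
      assume b: "?c \<le> b \<and> ?Q b < ?Q (min a ?c)"
      have "?Q b < ?Q k" if "a \<le> k" "k < b" for k
      proof (cases "k < ?c")
        case True
        then have "?Q a \<le> ?Q k" using inc[of a k] that I by (cases "a = k") auto
        then show ?thesis using b True that by auto
      next
        case False
        then show ?thesis using dec[of k b] that I by auto
      qed
      then show ?K using b dec[of b] I by auto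
    qed
  qed
  finally show ?thesis by blast
qed

text \<open>The same with the roles of the two branches exchanged: \<open>b\<close> is \<open>max a c\<close>, or is uncongested (\<open>b \<le> c\<close>)
  with a flux strictly below the supply of \<open>a\<close>.\<close>

lemma downstream_states_iff:
  assumes L: "fundamental_diagram L" and I: "a \<in> {0..jam L}" "b \<in> {0..jam L}"
  shows "(\<forall>k\<in>{a..<b}. flux L k < flux L b) \<and> (\<forall>k\<in>{b<..a}. flux L b < flux L k) \<longleftrightarrow>
    state_of L b = (capacity L, link_supply L a) \<or>
    (\<exists>D. state_of L b = (D, capacity L) \<and> D < link_supply L a)" (is "?K \<longleftrightarrow> ?states")
proof -
  let ?c = "crit L" and ?Q = "flux L"
  note inc = fundamental_diagram_strict(3)[OF L] and dec = fundamental_diagram_strict(4)[OF L]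
  note c = fundamental_diagram_strict(1,2)[OF L]
  have "?Q b = ?Q m \<longleftrightarrow> b = m" if "?c \<le> b" "?c \<le> m" "m \<le> jam L" for m
    using dec[of b m] dec[of m b] I that by (cases b m rule: linorder_cases) auto
  from this[of "max a ?c"] have "?Q b = ?Q (max a ?c) \<longleftrightarrow> b = max a ?c" if "?c \<le> b"
    using that I c by simp
  then have "?states \<longleftrightarrow> b = max a ?c \<or> b \<le> ?c \<and> ?Q b < ?Q (max a ?c)"
    using demand_eq_capacity_iff[OF L I(2)] supply_eq_capacity_iff[OF L I(2)]
    by (auto simp: state_of_def link_demand_def link_supply_def)
  also have "\<dots> \<longleftrightarrow> ?K"
  proof
    assume K: ?K
    consider "max a ?c < b" | "b = max a ?c" | "b < a" "?c < b" | "b < max a ?c" "b \<le> ?c" by linarith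
    then show "b = max a ?c \<or> b \<le> ?c \<and> ?Q b < ?Q (max a ?c)"
    proof cases
      case 1
      then have "?Q (max a ?c) < ?Q b" using K by auto
      then show ?thesis using dec[of "max a ?c" b] 1 I K by auto
    next
      case 3
      then have "?Q b < ?Q a" using K by auto
      then show ?thesis using dec[of b a] 3 I by auto
    next
      case 4
      then show ?thesis using K inc[of b ?c] I by (cases "a \<le> ?c") auto
    qed simp
  next
    assume "b = max a ?c \<or> b \<le> ?c \<and> ?Q b < ?Q (max a ?c)"
    then show ?K
    proof
      assume "b = max a ?c"
      then show ?K using inc[of _ ?c] I by (auto simp: max_def)
    next
      assume b: "b \<le> ?c \<and> ?Q b < ?Q (max a ?c)"
      have "?Q b < ?Q k" if "b < k" "k \<le> a" for k
      proof (cases "?c < k")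
        case True
        then have "?Q a \<le> ?Q k" using dec[of k a] that I by (cases "a = k") auto
        then show ?thesis using b True that by auto
      next
        case False
        then show ?thesis using inc[of b k] that I by auto
      qed
      then show ?K using b inc[of _ b] I by auto
    qed
  qed
  finally show ?thesis by blast
qed

lemma density_of_state:
  assumes "fundamental_diagram L" "U \<in> traffic_states L"
  shows "density L U \<in> {0..jam L}" "state_of L (density L U) = U"
  using bij_betwE[OF bij_betw_the_inv_into[OF bij_betw_state_of[OF assms(1)]]] assms(2)
    f_the_inv_into_f_bij_betw[OF bij_betw_state_of[OF assms(1)], of U]
  by (auto simp: density_def)

lemma flux_continuous: "fundamental_diagram L \<Longrightarrow> continuous_on {0..jam L} (flux L)"
  by (simp add: fundamental_diagram_def)

lemma admissible_upstream_iff: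
  assumes L: "fundamental_diagram L" and "(D, S) \<in> traffic_states L" "V \<in> traffic_states L"
  shows "admissible_upstream L (D, S) V \<longleftrightarrow>
    V = (D, capacity L) \<or> (\<exists>S'. V = (capacity L, S') \<and> S' < D)"
proof -
  note a = density_of_state[OF L assms(2)] and b = density_of_state[OF L assms(3)]
  have D: "link_demand L (density L (D, S)) = D" using a(2) by (simp add: state_of_def)
  have "admissible_upstream L (D, S) V \<longleftrightarrow> (\<exists>w. left_wave (flux L) {0..jam L} (density L (D, S)) (density L V) w)"
    by (simp add: admissible_upstream_def riemann_solution_def left_wave_def)
  also have "\<dots> \<longleftrightarrow> V = (D, capacity L) \<or> (\<exists>S'. V = (capacity L, S') \<and> S' < D)"
    using left_wave_iff[OF flux_continuous[OF L] a(1) b(1)] upstream_states_iff[OF L a(1) b(1)]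
    by (simp add: b(2) D)
  finally show ?thesis .
qed

lemma admissible_downstream_iff:
  assumes L: "fundamental_diagram L" and "(D, S) \<in> traffic_states L" "V \<in> traffic_states L"
  shows "admissible_downstream L (D, S) V \<longleftrightarrow>
    V = (capacity L, S) \<or> (\<exists>D'. V = (D', capacity L) \<and> D' < S)"
proof -
  note a = density_of_state[OF L assms(2)] and b = density_of_state[OF L assms(3)]
  have S: "link_supply L (density L (D, S)) = S" using a(2) by (simp add: state_of_def)
  have "admissible_downstream L (D, S) V \<longleftrightarrow> (\<exists>w. right_wave (flux L) {0..jam L} (density L (D, S)) (density L V) w)"
    by (simp add: admissible_downstream_def riemann_solution_def right_wave_def)
  also have "\<dots> \<longleftrightarrow> V = (capacity L, S) \<or> (\<exists>D'. V = (D', capacity L) \<and> D' < S)"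
    using right_wave_iff[OF flux_continuous[OF L] a(1) b(1)] downstream_states_iff[OF L a(1) b(1)]
    by (simp add: b(2) S)
  finally show ?thesis .
qed

theorem theorem1:
  fixes L1 L2 :: link and D1 S1 D2 S2 :: real and U1m U2p :: state
  assumes "fundamental_diagram L1" and "fundamental_diagram L2"
    and "(D1, S1) \<in> traffic_states L1" and "(D2, S2) \<in> traffic_states L2"
    and "U1m \<in> traffic_states L1" and "U2p \<in> traffic_states L2"
  shows "admissible_upstream L1 (D1, S1) U1m \<and> admissible_downstream L2 (D2, S2) U2p \<longleftrightarrow>
    (U1m = (D1, capacity L1) \<or> (\<exists>S1m. U1m = (capacity L1, S1m) \<and> S1m < D1)) \<and>
    (U2p = (capacity L2, S2) \<or> (\<exists>D2p. U2p = (D2p, capacity L2) \<and> D2p < S2))"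
  using admissible_upstream_iff[OF assms(1,3,5)] admissible_downstream_iff[OF assms(2,4,6)] by simp

end
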